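(* The quadruple $(H_\ell(\tilde X),\, m_{RT},\, 1,\, \Delta_\epsilon)$ is an $\epsilon$-unitary Hopf algebra with bijective antipode $S=-\sum_{n=0}^{\infty}\frac{1}{n!}(-D_\epsilon)^{n}$, where $D_\epsilon:=m_{RT}\Delta_\epsilon:H_\ell(\tilde X)\to H_\ell(\tilde X)$.
   Context: Let $\mathbf{k}$ be a field of characteristic $0$; linear maps and tensor products are over $\mathbf{k}$. For an associative algebra $A$, view $A\otimes A$ as an $A$-bimodule via $a\cdot(b\otimes c):=ab\otimes c$ and $(b\otimes c)\cdot a:=b\otimes ca$. An infinitesimal unitary bialgebra ($\epsilon$-unitary bialgebra) is a quadruple $(A,m,1,\Delta)$ where $(A,m,1)$ is a unitary associative algebra, $(A,\Delta)$ is a coassociative coalgebra (no counit required), and $\Delta(ab)=a\cdot\Delta(b)+\Delta(a)\cdot b$ for all $a,b\in A$. On $\mathrm{Hom}_{\mathbf{k}}(A,A)$ the convolution is $f*g=m(f\otimes g)\Delta$ and the circular convolution is $f\circledast g:=f*g+f+g$, for which the zero map is the unit. An $\epsilon$-unitary bialgebra $A$ is an infinitesimal unitary Hopf algebra ($\epsilon$-unitary Hopf algebra) if $\mathrm{id}\in\mathrm{Hom}_{\mathbf{k}}(A,A)$ is invertible with respect to $\circledast$; its inverse $S$ is called the antipode. It is characterized by $\sum_{(a)}S(a_{(1)})a_{(2)}+S(a)+a=0=\sum_{(a)}a_{(1)}S(a_{(2)})+S(a)+a$ for all $a\in A$, where $\Delta(a)=\sum_{(a)}a_{(1)}\otimes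 a_{(2)}$. Let $X$ be a set, $\sigma\notin X$ a symbol, and $\tilde X:=X\sqcup\{\sigma\}$. Consider planar rooted trees whose vertices are decorated by elements of $\tilde X$ in such a way that elements of $X$ decorate leaves only (all internal vertices, and possibly some leaves, are decorated by $\sigma$; the vertex of a one-vertex tree counts as a leaf). Let $\mathcal{T}_\ell(\tilde X)$ be the set of such trees, including by convention the empty tree $1$. Let $\mathcal{F}_\ell(\tilde X)$ be the free monoid generated by the nonempty such trees (planar decorated rooted forests, with concatenation as product and $1$ as identity), and let $H_\ell(\tilde X):=\mathbf{k}\mathcal{F}_\ell(\tilde X)$ be the $\mathbf{k}$-vector space with basis $\mathcal{F}_\ell(\tilde X)$, with the linearly extended concatenation product $m_{RT}$ and unit $1$. For $x\in\tilde X$, $\bullet_x$ is the one-vertex tree decorated by $x$. $B^+:H_\ell(\tilde X)\to H_\ell(\tilde X)$ is the linear grafting map with $B^+(1)=\bullet_\sigma$ that sends a forest to the tree obtained by grafting it onto a new root decorated by $\sigma$. Every nonempty tree in $\mathcal{T}_\ell(\tilde X)$ is either $\bullet_x$ with $x\in X$ or $B^+(\bar F)$ for a unique forest $\bar F\in\mathcal{F}_\ell(\tilde X)$. The linear map $\Delta_\epsilon:H_\ell(\tilde X)\to H_\ell(\tilde X)\otimes H_\ell(\tilde X)$ is defined recursively on forests by: $\Delta_\epsilon(1)=0$; $\Delta_\epsilon(\bullet_x)=1\otimes 1$ for $x\in X$; $\Delta_\epsilon(B^+(\bar F))=\bar F\otimes 1+(\mathrm{id}\otimes B^+)\Delta_\epsilon(\bar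 F)$ for $\bar F\in\mathcal{F}_\ell(\tilde X)$; and $\Delta_\epsilon(T_1T_2\cdots T_m)=T_1\cdot\Delta_\epsilon(T_2\cdots T_m)+\Delta_\epsilon(T_1)\cdot(T_2\cdots T_m)$ for nonempty trees $T_1,\dots,T_m\in\mathcal{T}_\ell(\tilde X)$, $m\ge 2$. In the formula for $S$, $(-D_\epsilon)^n$ denotes the $n$-fold composition power (with $(-D_\epsilon)^0=\mathrm{id}$), and the sum is understood pointwise: when evaluated on any given element only finitely many terms are nonzero. *)

theory Defs
  imports Complex_Main "HOL-Library.Poly_Mapping"
begin

section \<open>Vector spaces with a basis and their tensor products\<close>

text \<open>
  A vector space over a field \<open>'k\<close> is given by a basis \<open>B :: 'b set\<close>: it is the space of the
  finitely supported functions \<open>'b \<Rightarrow>\<^sub>0 'k\<close> whose support lies in \<open>B\<close>. The tensor product of the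
  spaces on \<open>B\<close> and \<open>C\<close> is the space on \<open>B \<times> C\<close>; the lemma \<open>tensor_universal_property\<close>
  below shows that it is the tensor product over \<open>'k\<close>.
\<close>

definition scale_pm :: "'k::field \<Rightarrow> ('b \<Rightarrow>\<^sub>0 'k) \<Rightarrow> ('b \<Rightarrow>\<^sub>0 'k)" (infixr "*\<^sub>k" 75) where
  "c *\<^sub>k u = Poly_Mapping.map ((*) c) u"

definition free_space :: "'b set \<Rightarrow> ('b \<Rightarrow>\<^sub>0 'k::field) set" where
  "free_space B = {u. Poly_Mapping.keys u \<subseteq> B}"

abbreviation basis_vec :: "'b \<Rightarrow> ('b \<Rightarrow>\<^sub>0 'k::field)" where
  "basis_vec b \<equiv> Poly_Mapping.single b 1"

definition linear_map_on ::
    "('b \<Rightarrow>\<^sub>0 'k::field) set \<Rightarrow> ('c \<Rightarrow>\<^sub>0 'k) set \<Rightarrow> (('b \<Rightarrow>\<^sub>0 'k) \<Rightarrow> ('c \<Rightarrow>\<^sub>0 'k)) \<Rightarrow> bool" where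
  "linear_map_on V W f \<longleftrightarrow>
     (\<forall>u\<in>V. f u \<in> W) \<and>
     (\<forall>u\<in>V. \<forall>v\<in>V. f (u + v) = f u + f v) \<and>
     (\<forall>c. \<forall>u\<in>V. f (c *\<^sub>k u) = c *\<^sub>k f u)"

definition bilinear_map_on ::
    "('b \<Rightarrow>\<^sub>0 'k::field) set \<Rightarrow> ('c \<Rightarrow>\<^sub>0 'k) set \<Rightarrow> ('d \<Rightarrow>\<^sub>0 'k) set \<Rightarrow>
     (('b \<Rightarrow>\<^sub>0 'k) \<Rightarrow> ('c \<Rightarrow>\<^sub>0 'k) \<Rightarrow> ('d \<Rightarrow>\<^sub>0 'k)) \<Rightarrow> bool" where
  "bilinear_map_on V W Z f \<longleftrightarrow>
     (\<forall>u\<in>V. linear_map_on W Z (f u)) \<and> (\<forall>v\<in>W. linear_map_on V Z (\<lambda>u. f u v))"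

definition lin_ext :: "('b \<Rightarrow> ('c \<Rightarrow>\<^sub>0 'k::field)) \<Rightarrow> ('b \<Rightarrow>\<^sub>0 'k) \<Rightarrow> ('c \<Rightarrow>\<^sub>0 'k)" where
  "lin_ext g u = (\<Sum>b\<in>Poly_Mapping.keys u. Poly_Mapping.lookup u b *\<^sub>k g b)"

definition tensor :: "('b \<Rightarrow>\<^sub>0 'k::field) \<Rightarrow> ('c \<Rightarrow>\<^sub>0 'k) \<Rightarrow> ('b \<times> 'c \<Rightarrow>\<^sub>0 'k)"
    (infixr "\<otimes>\<^sub>k" 70) where
  "u \<otimes>\<^sub>k v = lin_ext (\<lambda>b. lin_ext (\<lambda>c. basis_vec (b, c)) v) u"

text \<open>\<open>tensor_lift f\<close> is the linear map with \<open>u \<otimes>\<^sub>k v \<mapsto> f u v\<close>, for bilinear \<open>f\<close>.\<close>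

definition tensor_lift ::
    "(('b \<Rightarrow>\<^sub>0 'k::field) \<Rightarrow> ('c \<Rightarrow>\<^sub>0 'k) \<Rightarrow> ('d \<Rightarrow>\<^sub>0 'k)) \<Rightarrow> ('b \<times> 'c \<Rightarrow>\<^sub>0 'k) \<Rightarrow> ('d \<Rightarrow>\<^sub>0 'k)" where
  "tensor_lift f = lin_ext (\<lambda>(b, c). f (basis_vec b) (basis_vec c))"

text \<open>The map \<open>f \<otimes> g\<close> for linear maps \<open>f\<close> and \<open>g\<close>.\<close>

definition tensor_map ::
    "(('b \<Rightarrow>\<^sub>0 'k::field) \<Rightarrow> ('d \<Rightarrow>\<^sub>0 'k)) \<Rightarrow> (('c \<Rightarrow>\<^sub>0 'k) \<Rightarrow> ('e \<Rightarrow>\<^sub>0 'k)) \<Rightarrow>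
     ('b \<times> 'c \<Rightarrow>\<^sub>0 'k) \<Rightarrow> ('d \<times> 'e \<Rightarrow>\<^sub>0 'k)" where
  "tensor_map f g = tensor_lift (\<lambda>u v. f u \<otimes>\<^sub>k g v)"

text \<open>The canonical isomorphism \<open>(U \<otimes> V) \<otimes> W \<rightarrow> U \<otimes> (V \<otimes> W)\<close>.\<close>

definition tensor_assoc :: "(('b \<times> 'c) \<times> 'd \<Rightarrow>\<^sub>0 'k::field) \<Rightarrow> ('b \<times> ('c \<times> 'd) \<Rightarrow>\<^sub>0 'k)" where
  "tensor_assoc = tensor_lift (\<lambda>t w. tensor_lift (\<lambda>u v. u \<otimes>\<^sub>k (v \<otimes>\<^sub>k w)) t)"

lemma lookup_scale_pm [simp]:
  "Poly_Mapping.lookup (c *\<^sub>k u) b = c * Poly_Mapping.lookup u b"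
  by (simp add: scale_pm_def Poly_Mapping.map.rep_eq when_def)

interpretation scale_pm: vector_space "scale_pm :: 'k::field \<Rightarrow> ('b \<Rightarrow>\<^sub>0 'k) \<Rightarrow> _"
  by unfold_locales (rule poly_mapping_eqI, simp add: lookup_add algebra_simps)+

lemma lin_ext_superset:
  assumes "finite K" "Poly_Mapping.keys u \<subseteq> K"
  shows "lin_ext g u = (\<Sum>b\<in>K. Poly_Mapping.lookup u b *\<^sub>k g b)"
proof -
  show ?thesis
    unfolding lin_ext_def by (rule sum.mono_neutral_left) (use assms in \<open>auto simp: in_keys_iff\<close>)
qed

lemma lin_ext_add: "lin_ext g (u + v) = lin_ext g u + lin_ext g v"
proof -
  let ?K = "Poly_Mapping.keys u \<union> Poly_Mapping.keys v"
  have "Poly_Mapping.keys (u + v) \<subseteq> ?K" by (rule Poly_Mapping.keys_add)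
  then show ?thesis
    by (simp add: lin_ext_superset[of ?K] lookup_add scale_pm.scale_left_distrib sum.distrib)
qed

lemma lin_ext_scale: "lin_ext g (c *\<^sub>k u) = c *\<^sub>k lin_ext g u"
proof -
  have "Poly_Mapping.keys (c *\<^sub>k u) \<subseteq> Poly_Mapping.keys u" by (auto simp: in_keys_iff)
  then show ?thesis
    by (simp add: lin_ext_superset[of "Poly_Mapping.keys u"] scale_pm.scale_sum_right)
qed

lemma lin_ext_basis_vec [simp]: "lin_ext g (basis_vec b) = g b"
proof -
  show ?thesis by (simp add: lin_ext_def)
qed

lemma lin_ext_basis_vec_id: "lin_ext basis_vec u = u"
proof -
  have "c *\<^sub>k basis_vec b = Poly_Mapping.single b c" for c :: "'k::field" and b :: 'b
    by (rule poly_mapping_eqI) (simp add: lookup_single when_def)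
  then show ?thesis
    by (intro poly_mapping_eqI)
      (simp add: lin_ext_def lookup_sum lookup_single when_def in_keys_iff
        if_distrib[of "(*) _"] sum.delta cong: if_cong)
qed

lemma free_space_0: "0 \<in> free_space B"
  by (simp add: free_space_def)

lemma free_space_add: "u \<in> free_space B \<Longrightarrow> v \<in> free_space B \<Longrightarrow> u + v \<in> free_space B"
  using Poly_Mapping.keys_add[of u v] by (auto simp: free_space_def)

lemma free_space_scale: "u \<in> free_space B \<Longrightarrow> c *\<^sub>k u \<in> free_space B"
  by (auto simp: free_space_def in_keys_iff subset_iff)

lemma free_space_sum: "(\<And>i. i \<in> I \<Longrightarrow> h i \<in> free_space B) \<Longrightarrow> sum h I \<in> free_space B"
  by (induction I rule: infinite_finite_induct) (auto simp: free_space_0 free_space_add)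

lemma free_space_keys: "u \<in> free_space B \<Longrightarrow> b \<in> Poly_Mapping.keys u \<Longrightarrow> b \<in> B"
  by (auto simp: free_space_def)

lemma free_space_basis_vec: "b \<in> B \<Longrightarrow> basis_vec b \<in> free_space B"
  by (simp add: free_space_def)

lemma linear_lin_ext:
  "(\<And>b. b \<in> B \<Longrightarrow> g b \<in> free_space C) \<Longrightarrow> linear_map_on (free_space B) (free_space C) (lin_ext g)"
  unfolding linear_map_on_def
  by (simp add: lin_ext_add lin_ext_scale)
    (auto simp: lin_ext_def free_space_def[of B] intro!: free_space_sum free_space_scale)

lemma linear_map_on_sum:
  assumes f: "linear_map_on (free_space B) (free_space C) f"
    and h: "\<And>i. i \<in> I \<Longrightarrow> h i \<in> free_space B"
  shows "f (sum h I) = (\<Sum>i\<in>I. f (h i))"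
proof -
  have "0 *\<^sub>k (0 :: 'a \<Rightarrow>\<^sub>0 'b) = 0" "0 *\<^sub>k f 0 = 0" by (rule poly_mapping_eqI, simp)+
  then have f0: "f 0 = 0"
    using f free_space_0[of B] unfolding linear_map_on_def by metis
  show ?thesis
    using h
  proof (induction I rule: infinite_finite_induct)
    case (insert i I)
    then show ?case
      using f free_space_sum[of I h B] by (simp add: linear_map_on_def)
  qed (simp_all add: f0)
qed

lemma linear_map_on_eq_lin_ext:
  assumes "linear_map_on (free_space B) (free_space C) f" "u \<in> free_space B"
  shows "f u = lin_ext (\<lambda>b. f (basis_vec b)) u"
proof -
  have "f u = f (\<Sum>b\<in>Poly_Mapping.keys u. Poly_Mapping.lookup u b *\<^sub>k basis_vec b)"
    using lin_ext_basis_vec_id[of u] by (simp add: lin_ext_def)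
  also have "\<dots> = (\<Sum>b\<in>Poly_Mapping.keys u. f (Poly_Mapping.lookup u b *\<^sub>k basis_vec b))"
    by (rule linear_map_on_sum[OF assms(1)])
      (use assms(2) in \<open>blast intro: free_space_scale free_space_basis_vec dest: free_space_keys\<close>)
  also have "\<dots> = lin_ext (\<lambda>b. f (basis_vec b)) u"
    unfolding lin_ext_def
    by (rule sum.cong) (use assms in \<open>auto simp: linear_map_on_def free_space_def\<close>)
  finally show ?thesis .
qed

lemma tensor_basis_vec [simp]: "basis_vec b \<otimes>\<^sub>k basis_vec c = basis_vec (b, c)"
  by (simp add: tensor_def)

lemma bilinear_tensor:
  "bilinear_map_on (free_space B) (free_space C) (free_space (B \<times> C))
     ((\<otimes>\<^sub>k) :: ('b \<Rightarrow>\<^sub>0 'k::field) \<Rightarrow> ('c \<Rightarrow>\<^sub>0 'k) \<Rightarrow> _)"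
proof -
  have 1: "lin_ext (\<lambda>c. basis_vec (b, c)) v \<in> free_space (B \<times> C)"
    if "b \<in> B" "v \<in> free_space C" for b and v :: "'c \<Rightarrow>\<^sub>0 'k"
    using linear_lin_ext[of C "\<lambda>c. basis_vec (b, c)" "B \<times> C"] that
    by (auto simp: linear_map_on_def free_space_basis_vec)
  have 2: "linear_map_on (free_space B) (free_space (B \<times> C)) (\<lambda>u. u \<otimes>\<^sub>k v)"
    if "v \<in> free_space C" for v :: "'c \<Rightarrow>\<^sub>0 'k"
    unfolding tensor_def by (rule linear_lin_ext) (rule 1[OF _ that])
  have 3: "u \<otimes>\<^sub>k (v + w) = u \<otimes>\<^sub>k v + u \<otimes>\<^sub>k w" for u :: "'b \<Rightarrow>\<^sub>0 'k" and v w :: "'c \<Rightarrow>\<^sub>0 'k"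
    by (simp add: tensor_def lin_ext_add)
      (simp add: lin_ext_def[of _ u] scale_pm.scale_right_distrib sum.distrib)
  have 4: "u \<otimes>\<^sub>k (c *\<^sub>k v) = c *\<^sub>k (u \<otimes>\<^sub>k v)" for c and u :: "'b \<Rightarrow>\<^sub>0 'k" and v :: "'c \<Rightarrow>\<^sub>0 'k"
    by (simp add: tensor_def lin_ext_scale)
      (simp add: lin_ext_def[of _ u] scale_pm.scale_sum_right mult.commute)
  show ?thesis
    using 2 by (auto simp: bilinear_map_on_def linear_map_on_def[of "free_space C"] 3 4)
      (auto simp: linear_map_on_def)
qed

theorem tensor_universal_property:
  fixes f :: "('b \<Rightarrow>\<^sub>0 'k::field) \<Rightarrow> ('c \<Rightarrow>\<^sub>0 'k) \<Rightarrow> ('d \<Rightarrow>\<^sub>0 'k)"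
  assumes f: "bilinear_map_on (free_space B) (free_space C) (free_space D) f"
  shows "linear_map_on (free_space (B \<times> C)) (free_space D) (tensor_lift f)"
    and "\<And>u v. u \<in> free_space B \<Longrightarrow> v \<in> free_space C \<Longrightarrow> tensor_lift f (u \<otimes>\<^sub>k v) = f u v"
    and "\<And>h t. linear_map_on (free_space (B \<times> C)) (free_space D) h \<Longrightarrow>
           (\<And>u v. u \<in> free_space B \<Longrightarrow> v \<in> free_space C \<Longrightarrow> h (u \<otimes>\<^sub>k v) = f u v) \<Longrightarrow>
           t \<in> free_space (B \<times> C) \<Longrightarrow> h t = tensor_lift f t"
proof -
  show lin: "linear_map_on (free_space (B \<times> C)) (free_space D) (tensor_lift f)"
    unfolding tensor_lift_def
    by (rule linear_lin_ext)
      (use f in \<open>auto simp: bilinear_map_on_def linear_map_on_def free_space_basis_vec\<close>)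
  show "tensor_lift f (u \<otimes>\<^sub>k v) = f u v" if u: "u \<in> free_space B" and v: "v \<in> free_space C" for u v
  proof -
    have uk: "b \<in> B" if "b \<in> Poly_Mapping.keys u" for b using u that by (auto simp: free_space_def)
    have tl: "linear_map_on (free_space B) (free_space D) (\<lambda>u. tensor_lift f (u \<otimes>\<^sub>k v))"
      if "v \<in> free_space C" for v
      using lin bilinear_tensor[of B C] that
      by (auto simp: bilinear_map_on_def linear_map_on_def)
    have tr: "linear_map_on (free_space C) (free_space D) (\<lambda>v. tensor_lift f (u \<otimes>\<^sub>k v))"
      if "u \<in> free_space B" for u
      using lin bilinear_tensor[of B C] that
      by (auto simp: bilinear_map_on_def linear_map_on_def)
    have fl: "linear_map_on (free_space B) (free_space D) (\<lambda>u. f u v)"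
      using f v by (simp add: bilinear_map_on_def)
    have eq: "tensor_lift f (basis_vec b \<otimes>\<^sub>k v) = f (basis_vec b) v" if "b \<in> B" for b
    proof -
      have b: "(basis_vec b :: 'b \<Rightarrow>\<^sub>0 'k) \<in> free_space B" using that by (rule free_space_basis_vec)
      have "linear_map_on (free_space C) (free_space D) (f (basis_vec b))"
        using f b by (simp add: bilinear_map_on_def)
      from linear_map_on_eq_lin_ext[OF this v] linear_map_on_eq_lin_ext[OF tr[OF b] v]
      show ?thesis by (simp add: tensor_lift_def)
    qed
    show ?thesis
      using linear_map_on_eq_lin_ext[OF tl[OF v] u] linear_map_on_eq_lin_ext[OF fl u] uk
      by (simp add: lin_ext_def eq)
  qed
  show "h t = tensor_lift f t"
    if h: "linear_map_on (free_space (B \<times> C)) (free_space D) h"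
      and hf: "\<And>u v. u \<in> free_space B \<Longrightarrow> v \<in> free_space C \<Longrightarrow> h (u \<otimes>\<^sub>k v) = f u v"
      and t: "t \<in> free_space (B \<times> C)" for h t
  proof -
    have "h (basis_vec (b, c)) = f (basis_vec b) (basis_vec c)" if "b \<in> B" "c \<in> C" for b c
      using hf[of "basis_vec b" "basis_vec c"] that by (simp add: free_space_basis_vec)
    with t show ?thesis
      unfolding linear_map_on_eq_lin_ext[OF h t] tensor_lift_def lin_ext_def
      by (intro sum.cong) (auto simp: free_space_def)
  qed
qed


section \<open>Infinitesimal unitary bialgebras and Hopf algebras\<close>

text \<open>
  Structures on the space with basis \<open>B\<close>; only the values of the operations on that space matter.
\<close>

locale unitary_algebra =
  fixes B :: "'b set"
    and m :: "('b \<Rightarrow>\<^sub>0 'k::field) \<Rightarrow> ('b \<Rightarrow>\<^sub>0 'k) \<Rightarrow> ('b \<Rightarrow>\<^sub>0 'k)"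
    and one :: "'b \<Rightarrow>\<^sub>0 'k"
  assumes mult_bilinear: "bilinear_map_on (free_space B) (free_space B) (free_space B) m"
    and mult_assoc: "\<lbrakk>a \<in> free_space B; b \<in> free_space B; c \<in> free_space B\<rbrakk> \<Longrightarrow>
                     m (m a b) c = m a (m b c)"
    and one_closed: "one \<in> free_space B"
    and mult_one_left: "a \<in> free_space B \<Longrightarrow> m one a = a"
    and mult_one_right: "a \<in> free_space B \<Longrightarrow> m a one = a"

locale noncounital_coalgebra =
  fixes B :: "'b set"
    and \<Delta> :: "('b \<Rightarrow>\<^sub>0 'k::field) \<Rightarrow> ('b \<times> 'b \<Rightarrow>\<^sub>0 'k)"
  assumes comult_linear: "linear_map_on (free_space B) (free_space (B \<times> B)) \<Delta>"
    and coassoc: "a \<in> free_space B \<Longrightarrow>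
                  tensor_assoc (tensor_map \<Delta> id (\<Delta> a)) = tensor_map id \<Delta> (\<Delta> a)"

definition left_act ::
    "(('b \<Rightarrow>\<^sub>0 'k::field) \<Rightarrow> ('b \<Rightarrow>\<^sub>0 'k) \<Rightarrow> ('b \<Rightarrow>\<^sub>0 'k)) \<Rightarrow>
     ('b \<Rightarrow>\<^sub>0 'k) \<Rightarrow> ('b \<times> 'b \<Rightarrow>\<^sub>0 'k) \<Rightarrow> ('b \<times> 'b \<Rightarrow>\<^sub>0 'k)" where
  "left_act m a t = tensor_lift (\<lambda>b c. m a b \<otimes>\<^sub>k c) t"

definition right_act ::
    "(('b \<Rightarrow>\<^sub>0 'k::field) \<Rightarrow> ('b \<Rightarrow>\<^sub>0 'k) \<Rightarrow> ('b \<Rightarrow>\<^sub>0 'k)) \<Rightarrow>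
     ('b \<times> 'b \<Rightarrow>\<^sub>0 'k) \<Rightarrow> ('b \<Rightarrow>\<^sub>0 'k) \<Rightarrow> ('b \<times> 'b \<Rightarrow>\<^sub>0 'k)" where
  "right_act m t a = tensor_lift (\<lambda>b c. b \<otimes>\<^sub>k m c a) t"

locale eps_unitary_bialgebra = unitary_algebra B m one + noncounital_coalgebra B \<Delta>
  for B :: "'b set"
    and m :: "('b \<Rightarrow>\<^sub>0 'k::field) \<Rightarrow> ('b \<Rightarrow>\<^sub>0 'k) \<Rightarrow> ('b \<Rightarrow>\<^sub>0 'k)"
    and one :: "'b \<Rightarrow>\<^sub>0 'k"
    and \<Delta> :: "('b \<Rightarrow>\<^sub>0 'k) \<Rightarrow> ('b \<times> 'b \<Rightarrow>\<^sub>0 'k)" +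
  assumes comult_derivation: "\<lbrakk>a \<in> free_space B; b \<in> free_space B\<rbrakk> \<Longrightarrow>
            \<Delta> (m a b) = left_act m a (\<Delta> b) + right_act m (\<Delta> a) b"

definition convolution ::
    "(('b \<Rightarrow>\<^sub>0 'k::field) \<Rightarrow> ('b \<Rightarrow>\<^sub>0 'k) \<Rightarrow> ('b \<Rightarrow>\<^sub>0 'k)) \<Rightarrow>
     (('b \<Rightarrow>\<^sub>0 'k) \<Rightarrow> ('b \<times> 'b \<Rightarrow>\<^sub>0 'k)) \<Rightarrow>
     (('b \<Rightarrow>\<^sub>0 'k) \<Rightarrow> ('b \<Rightarrow>\<^sub>0 'k)) \<Rightarrow> (('b \<Rightarrow>\<^sub>0 'k) \<Rightarrow> ('b \<Rightarrow>\<^sub>0 'k)) \<Rightarrow>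
     ('b \<Rightarrow>\<^sub>0 'k) \<Rightarrow> ('b \<Rightarrow>\<^sub>0 'k)" where
  "convolution m \<Delta> f g a = tensor_lift m (tensor_map f g (\<Delta> a))"

definition circ_convolution ::
    "(('b \<Rightarrow>\<^sub>0 'k::field) \<Rightarrow> ('b \<Rightarrow>\<^sub>0 'k) \<Rightarrow> ('b \<Rightarrow>\<^sub>0 'k)) \<Rightarrow>
     (('b \<Rightarrow>\<^sub>0 'k) \<Rightarrow> ('b \<times> 'b \<Rightarrow>\<^sub>0 'k)) \<Rightarrow>
     (('b \<Rightarrow>\<^sub>0 'k) \<Rightarrow> ('b \<Rightarrow>\<^sub>0 'k)) \<Rightarrow> (('b \<Rightarrow>\<^sub>0 'k) \<Rightarrow> ('b \<Rightarrow>\<^sub>0 'k)) \<Rightarrow>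
     ('b \<Rightarrow>\<^sub>0 'k) \<Rightarrow> ('b \<Rightarrow>\<^sub>0 'k)" where
  "circ_convolution m \<Delta> f g a = convolution m \<Delta> f g a + f a + g a"

text \<open>\<open>S\<close> is a two-sided inverse of \<open>id\<close> for \<open>circ_convolution\<close>, whose unit is the zero map.\<close>

definition is_antipode ::
    "'b set \<Rightarrow> (('b \<Rightarrow>\<^sub>0 'k::field) \<Rightarrow> ('b \<Rightarrow>\<^sub>0 'k) \<Rightarrow> ('b \<Rightarrow>\<^sub>0 'k)) \<Rightarrow>
     (('b \<Rightarrow>\<^sub>0 'k) \<Rightarrow> ('b \<times> 'b \<Rightarrow>\<^sub>0 'k)) \<Rightarrow> (('b \<Rightarrow>\<^sub>0 'k) \<Rightarrow> ('b \<Rightarrow>\<^sub>0 'k)) \<Rightarrow> bool" where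
  "is_antipode B m \<Delta> S \<longleftrightarrow>
     linear_map_on (free_space B) (free_space B) S \<and>
     (\<forall>a\<in>free_space B. circ_convolution m \<Delta> S id a = 0 \<and> circ_convolution m \<Delta> id S a = 0)"

locale eps_unitary_Hopf_algebra = eps_unitary_bialgebra +
  assumes antipode_exists: "\<exists>S. is_antipode B m \<Delta> S"


section \<open>Leaf-decorated planar rooted forests\<close>

text \<open>
  Planar rooted trees decorated by \<open>X \<squnion> {\<sigma>}\<close> with elements of \<open>X\<close> on leaves only:
  \<open>Leaf x\<close> is the one-vertex tree decorated by \<open>x \<in> X\<close>, and \<open>Graft ts\<close> has a root decorated
  by \<open>\<sigma>\<close> with the planar list \<open>ts\<close> of subtrees, so that \<open>Graft []\<close> is the one-vertex tree
  decorated by \<open>\<sigma>\<close>. The free monoid on the trees consists of the lists of trees; the empty list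
  is the identity \<open>1\<close>, also called the empty tree. The set \<open>X\<close> may be empty.
\<close>

datatype (leaves: 'x) ltree = Leaf 'x | Graft "'x ltree list"

type_synonym 'x forest = "'x ltree list"

definition forests :: "'x set \<Rightarrow> 'x forest set" where
  "forests X = lists {T. leaves T \<subseteq> X}"

definition H_ell :: "'x set \<Rightarrow> ('x forest \<Rightarrow>\<^sub>0 'k::field) set" where
  "H_ell X = free_space (forests X)"

definition m_RT :: "('x forest \<Rightarrow>\<^sub>0 'k::field) \<Rightarrow> ('x forest \<Rightarrow>\<^sub>0 'k) \<Rightarrow> ('x forest \<Rightarrow>\<^sub>0 'k)" where
  "m_RT u v = lin_ext (\<lambda>F. lin_ext (\<lambda>G. basis_vec (F @ G)) v) u"

definition one_RT :: "'x forest \<Rightarrow>\<^sub>0 'k::field" where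
  "one_RT = basis_vec []"

definition B_plus :: "('x forest \<Rightarrow>\<^sub>0 'k::field) \<Rightarrow> ('x forest \<Rightarrow>\<^sub>0 'k)" where
  "B_plus = lin_ext (\<lambda>F. basis_vec [Graft F])"

fun Delta_forest :: "'x forest \<Rightarrow> ('x forest \<times> 'x forest \<Rightarrow>\<^sub>0 'k::field)" where
  "Delta_forest [] = 0"
| "Delta_forest [Leaf x] = one_RT \<otimes>\<^sub>k one_RT"
| "Delta_forest [Graft F] = basis_vec F \<otimes>\<^sub>k one_RT + tensor_map id B_plus (Delta_forest F)"
| "Delta_forest (T1 # T2 # Ts) =
     left_act m_RT (basis_vec [T1]) (Delta_forest (T2 # Ts)) +
     right_act m_RT (Delta_forest [T1]) (basis_vec (T2 # Ts))"

definition Delta_eps :: "('x forest \<Rightarrow>\<^sub>0 'k::field) \<Rightarrow> ('x forest \<times> 'x forest \<Rightarrow>\<^sub>0 'k)" where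
  "Delta_eps = lin_ext Delta_forest"

definition D_eps :: "('x forest \<Rightarrow>\<^sub>0 'k::field) \<Rightarrow> ('x forest \<Rightarrow>\<^sub>0 'k)" where
  "D_eps a = tensor_lift m_RT (Delta_eps a)"

end

(* In an infinitesimal bialgebra D = m \<circ> \<Delta> = id * id is a derivation for the product, hence for
   the convolution, so coassociativity gives D (id^{*k}) = k id^{*(k+1)} and D^n = n! id^{*(n+1)}.
   When D is locally nilpotent, the series S = \<Sum>n. (-1)^(n+1) id^{*(n+1)} = - exp (- D) therefore
   makes sense, and S * id = id * S = - S - id by telescoping. On forests, \<Delta> removes exactly one
   vertex, so D is locally nilpotent. *)
theory Submission
  imports Defs
begin

section \<open>Calculus of linear extensions\<close>

text \<open>The number of nonzero terms of the series varies with the argument, so \<open>S\<close>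
  is not visibly linear and cannot be convolved term by term. Its properties are proved for
  truncations \<open>S_trunc N\<close>, which are linear, and transferred by a bound
  \<open>N\<close> common to the finitely many elements involved. Bijectivity does not use the
  inverse - exp(D), which would mean multiplying two such series. By local nilpotence the kernels of
  the powers of D exhaust the space, and \<open>S\<close> is triangular for this filtration, with -
  id on the diagonal.\<close>

lemma lin_ext_cong:
  "(\<And>b. b \<in> Poly_Mapping.keys u \<Longrightarrow> g b = h b) \<Longrightarrow> lin_ext g u = lin_ext h u"
  by (simp add: lin_ext_def)

lemma lin_ext_0 [simp]: "lin_ext g 0 = 0"
  by (simp add: lin_ext_def)

lemma lin_ext_sum: "lin_ext g (sum h I) = (\<Sum>i\<in>I. lin_ext g (h i))"
  by (induction I rule: infinite_finite_induct) (simp_all add: lin_ext_add)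

lemma lin_ext_fun_add: "lin_ext (\<lambda>b. g b + h b) u = lin_ext g u + lin_ext h u"
  by (simp add: lin_ext_def scale_pm.scale_right_distrib sum.distrib)

lemma lin_ext_fun_scale: "lin_ext (\<lambda>b. c *\<^sub>k g b) u = c *\<^sub>k lin_ext g u"
  by (simp add: lin_ext_def scale_pm.scale_sum_right mult.commute)

lemma lin_ext_fun_0 [simp]: "lin_ext (\<lambda>_. 0) u = 0"
  by (simp add: lin_ext_def)

lemma lin_ext_lin_ext: "lin_ext g (lin_ext f u) = lin_ext (\<lambda>b. lin_ext g (f b)) u"
  by (subst (2) lin_ext_def) (simp add: lin_ext_sum lin_ext_scale, simp add: lin_ext_def)

lemma lin_ext_swap:
  "lin_ext (\<lambda>b. lin_ext (g b) v) u = lin_ext (\<lambda>c. lin_ext (\<lambda>b. g b c) u) v"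
  unfolding lin_ext_def scale_pm.scale_sum_right
  by (subst sum.swap) (simp add: mult.commute)

lemma lin_ext_closed:
  "(\<And>b. b \<in> Poly_Mapping.keys u \<Longrightarrow> g b \<in> free_space C) \<Longrightarrow> lin_ext g u \<in> free_space C"
  by (auto simp: lin_ext_def intro!: free_space_sum free_space_scale)

text \<open>\<open>h\<close> is linear only on its free space, hence the condition on
  \<open>g\<close>; in \<open>lin_ext_lin_ext\<close> the outer map is linear everywhere.\<close>

lemma linear_map_on_lin_ext:
  assumes h: "linear_map_on (free_space B) (free_space C) h"
    and g: "\<And>b. b \<in> Poly_Mapping.keys u \<Longrightarrow> g b \<in> free_space B"
  shows "h (lin_ext g u) = lin_ext (\<lambda>b. h (g b)) u"
proof -
  have "h (lin_ext g u) = (\<Sum>b\<in>Poly_Mapping.keys u. h (Poly_Mapping.lookup u b *\<^sub>k g b))"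
    unfolding lin_ext_def by (rule linear_map_on_sum[OF h]) (use g in \<open>auto intro: free_space_scale\<close>)
  also have "\<dots> = lin_ext (\<lambda>b. h (g b)) u"
    unfolding lin_ext_def by (rule sum.cong) (use h g in \<open>auto simp: linear_map_on_def\<close>)
  finally show ?thesis .
qed

lemma lin_ext_basis_vec_pair [simp]: "lin_ext (\<lambda>(b, c). basis_vec (b, c)) t = (t :: 'b \<times> 'c \<Rightarrow>\<^sub>0 'k::field)"
proof -
  have "(\<lambda>(b, c). basis_vec (b, c) :: 'b \<times> 'c \<Rightarrow>\<^sub>0 'k) = basis_vec" by auto
  then show ?thesis by (simp only: lin_ext_basis_vec_id)
qed

section \<open>Expansions over tensor products\<close>

lemma lin_ext_tensor: "lin_ext g (u \<otimes>\<^sub>k v) = lin_ext (\<lambda>b. lin_ext (\<lambda>c. g (b, c)) v) u"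
  by (simp add: tensor_def lin_ext_lin_ext)

lemma tensor_map_eq:
  "tensor_map f g t = lin_ext (\<lambda>(b, c). f (basis_vec b) \<otimes>\<^sub>k g (basis_vec c)) t"
  by (simp add: tensor_map_def tensor_lift_def)

lemma tensor_assoc_eq: "tensor_assoc = lin_ext (\<lambda>((b, c), d). basis_vec (b, (c, d)))"
  by (simp add: tensor_assoc_def tensor_lift_def fun_eq_iff case_prod_unfold)

text \<open>With its companion for the right leg, this turns coassociativity into an equality of
  double sums for any \<open>G\<close> on basis triples.\<close>

lemma lin_ext_left_comult:
  "lin_ext G (tensor_assoc (tensor_map \<Delta> id t)) =
   lin_ext (\<lambda>(b, c). lin_ext (\<lambda>(p, q). G (p, (q, c))) (\<Delta> (basis_vec b))) t"
  by (simp add: tensor_assoc_eq tensor_map_eq lin_ext_lin_ext case_prod_unfold lin_ext_tensor)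

lemma lin_ext_right_comult:
  "lin_ext G (tensor_map id \<Delta> t) =
   lin_ext (\<lambda>(b, c). lin_ext (\<lambda>p. G (b, p)) (\<Delta> (basis_vec c))) t"
  by (simp add: tensor_map_eq lin_ext_lin_ext case_prod_unfold lin_ext_tensor)

lemma free_space_uminus: "u \<in> free_space B \<Longrightarrow> - u \<in> free_space B"
  by (simp add: free_space_def)

lemma linear_map_onD:
  assumes "linear_map_on V W f"
  shows "u \<in> V \<Longrightarrow> f u \<in> W" "u \<in> V \<Longrightarrow> v \<in> V \<Longrightarrow> f (u + v) = f u + f v"
    "u \<in> V \<Longrightarrow> f (c *\<^sub>k u) = c *\<^sub>k f u"
  using assms by (auto simp: linear_map_on_def)

lemma linear_map_on_0: "linear_map_on (free_space B) W f \<Longrightarrow> f 0 = 0"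
  using linear_map_onD(3)[of "free_space B" W f 0 0] by (simp add: free_space_0)

lemma linear_map_on_uminus:
  "linear_map_on (free_space B) W f \<Longrightarrow> u \<in> free_space B \<Longrightarrow> f (- u) = - f u"
  using linear_map_onD(3)[of "free_space B" W f u "- 1"] by simp

lemma linear_map_on_id: "linear_map_on V V id"
  by (simp add: linear_map_on_def)

lemma linear_map_on_compose:
  "linear_map_on U V f \<Longrightarrow> linear_map_on V W g \<Longrightarrow> linear_map_on U W (\<lambda>a. g (f a))"
  by (simp add: linear_map_on_def)

lemma linear_map_on_add_fun:
  "linear_map_on V (free_space B) f \<Longrightarrow> linear_map_on V (free_space B) g \<Longrightarrow>
   linear_map_on V (free_space B) (\<lambda>a. f a + g a)"
  by (simp add: linear_map_on_def free_space_add scale_pm.scale_right_distrib)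

lemma linear_map_on_scale_fun:
  "linear_map_on V (free_space B) f \<Longrightarrow> linear_map_on V (free_space B) (\<lambda>a. c *\<^sub>k f a)"
  by (simp add: linear_map_on_def free_space_scale scale_pm.scale_right_distrib mult.commute)

section \<open>Convolution in an infinitesimal bialgebra\<close>

context eps_unitary_bialgebra
begin

abbreviation V :: "('b \<Rightarrow>\<^sub>0 'k) set" where "V \<equiv> free_space B"
abbreviation "lin \<equiv> linear_map_on V V"
abbreviation "conv \<equiv> convolution m \<Delta>"

section \<open>Sweedler formula and associativity of convolution\<close>

lemma mult_closed: "u \<in> V \<Longrightarrow> v \<in> V \<Longrightarrow> m u v \<in> V"
  using mult_bilinear by (auto simp: bilinear_map_on_def linear_map_on_def)

lemma lin_mult_left: "u \<in> V \<Longrightarrow> lin (m u)"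
  using mult_bilinear by (simp add: bilinear_map_on_def)

lemma lin_mult_right: "v \<in> V \<Longrightarrow> lin (\<lambda>u. m u v)"
  using mult_bilinear by (simp add: bilinear_map_on_def)

lemma keys_comult:
  "a \<in> V \<Longrightarrow> (b, c) \<in> Poly_Mapping.keys (\<Delta> a) \<Longrightarrow>
   (basis_vec b :: _ \<Rightarrow>\<^sub>0 'k) \<in> V \<and> (basis_vec c :: _ \<Rightarrow>\<^sub>0 'k) \<in> V"
  using linear_map_onD(1)[OF comult_linear, of a] by (auto simp: free_space_def)

text \<open>The Sweedler formula. Linearity of \<open>f\<close> and \<open>g\<close> keeps both
  factors in \<open>V\<close>, where \<open>m\<close> is bilinear.\<close>

lemma conv_eq:
  assumes "lin f" "lin g" "a \<in> V"
  shows "conv f g a = lin_ext (\<lambda>(b, c). m (f (basis_vec b)) (g (basis_vec c))) (\<Delta> a)"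
proof -
  have "conv f g a =
      lin_ext (\<lambda>(b, c). tensor_lift m (f (basis_vec b) \<otimes>\<^sub>k g (basis_vec c))) (\<Delta> a)"
    by (simp add: convolution_def tensor_map_eq tensor_lift_def lin_ext_lin_ext case_prod_unfold)
  also have "\<dots> = lin_ext (\<lambda>(b, c). m (f (basis_vec b)) (g (basis_vec c))) (\<Delta> a)"
    by (rule lin_ext_cong)
      (use keys_comult[OF assms(3)] linear_map_onD(1)[OF assms(1)] linear_map_onD(1)[OF assms(2)] in
        \<open>auto simp: tensor_universal_property(2)[OF mult_bilinear]\<close>)
  finally show ?thesis .
qed

lemma conv_linear:
  assumes "lin f" "lin g"
  shows "lin (conv f g)"
proof -
  let ?h = "lin_ext (\<lambda>(b, c). m (f (basis_vec b)) (g (basis_vec c)))"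
  have "linear_map_on (free_space (B \<times> B)) V ?h"
    by (rule linear_lin_ext)
      (auto intro!: mult_closed linear_map_onD(1)[OF assms(1)] linear_map_onD(1)[OF assms(2)]
        free_space_basis_vec)
  from linear_map_on_compose[OF comult_linear this] show ?thesis
    by (simp add: linear_map_on_def conv_eq[OF assms] free_space_add free_space_scale)
qed

text \<open>Identities such as the antipode equation hold on \<open>V\<close> only and are not
  equalities of functions. They may be substituted because the legs of \<open>\<Delta> a\<close> lie
  in \<open>V\<close>.\<close>

lemma conv_cong:
  assumes "lin f" "lin g" "lin f'" "lin g'" "a \<in> V"
    and "\<And>b. b \<in> V \<Longrightarrow> f b = f' b" "\<And>b. b \<in> V \<Longrightarrow> g b = g' b"
  shows "conv f g a = conv f' g' a"
  unfolding conv_eq[OF assms(1,2,5)] conv_eq[OF assms(3-5)]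
  by (rule lin_ext_cong) (use keys_comult[OF assms(5)] assms(6,7) in auto)

text \<open>Both sides sum the threefold product \<open>?G\<close> over an iterated coproduct:
  associativity of \<open>m\<close> rebrackets the summands, coassociativity identifies the
  sums.\<close>

lemma conv_assoc:
  assumes f: "lin f" and g: "lin g" and h: "lin h" and a: "a \<in> V"
  shows "conv (conv f g) h a = conv f (conv g h) a"
proof -
  let ?e = "basis_vec :: 'b \<Rightarrow> 'b \<Rightarrow>\<^sub>0 'k"
  let ?G = "\<lambda>(p, q, r). m (f (?e p)) (m (g (?e q)) (h (?e r)))"
  note cl = linear_map_onD(1)[OF f] linear_map_onD(1)[OF g] linear_map_onD(1)[OF h]
  have "m (conv f g (?e b)) (h (?e c)) = lin_ext (\<lambda>(p, q). ?G (p, q, c)) (\<Delta> (?e b))"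
    if b: "?e b \<in> V" and c: "?e c \<in> V" for b c
  proof -
    have "m (conv f g (?e b)) (h (?e c)) =
        lin_ext (\<lambda>p. m (case p of (p, q) \<Rightarrow> m (f (?e p)) (g (?e q))) (h (?e c))) (\<Delta> (?e b))"
      unfolding conv_eq[OF f g b]
      by (rule linear_map_on_lin_ext[OF lin_mult_right[OF cl(3)[OF c]]])
        (use keys_comult[OF b] in \<open>auto intro!: mult_closed cl\<close>)
    also have "\<dots> = lin_ext (\<lambda>(p, q). ?G (p, q, c)) (\<Delta> (?e b))"
      by (rule lin_ext_cong) (use keys_comult[OF b] c in \<open>auto simp: mult_assoc cl\<close>)
    finally show ?thesis .
  qed
  then have "conv (conv f g) h a =
      lin_ext (\<lambda>(b, c). lin_ext (\<lambda>(p, q). ?G (p, q, c)) (\<Delta> (?e b))) (\<Delta> a)"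
    unfolding conv_eq[OF conv_linear[OF f g] h a]
    by (intro lin_ext_cong) (use keys_comult[OF a] in auto)
  also have "\<dots> = lin_ext ?G (tensor_assoc (tensor_map \<Delta> id (\<Delta> a)))"
    by (simp add: lin_ext_left_comult)
  also have "\<dots> = lin_ext (\<lambda>(b, c). lin_ext (\<lambda>p. ?G (b, p)) (\<Delta> (?e c))) (\<Delta> a)"
    unfolding coassoc[OF a] by (rule lin_ext_right_comult)
  also have "\<dots> = conv f (conv g h) a"
  proof -
    have "m (f (?e b)) (conv g h (?e c)) = lin_ext (\<lambda>p. ?G (b, p)) (\<Delta> (?e c))"
      if b: "?e b \<in> V" and c: "?e c \<in> V" for b c
    proof -
      have "m (f (?e b)) (conv g h (?e c)) =
          lin_ext (\<lambda>p. m (f (?e b)) (case p of (p, q) \<Rightarrow> m (g (?e p)) (h (?e q)))) (\<Delta> (?e c))"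
        unfolding conv_eq[OF g h c]
        by (rule linear_map_on_lin_ext[OF lin_mult_left[OF cl(1)[OF b]]])
          (use keys_comult[OF c] in \<open>auto intro!: mult_closed cl\<close>)
      then show ?thesis by (simp add: case_prod_unfold)
    qed
    then show ?thesis
      unfolding conv_eq[OF f conv_linear[OF g h] a]
      by (intro lin_ext_cong) (use keys_comult[OF a] in auto)
  qed
  finally show ?thesis .
qed

lemma conv_add_left:
  assumes "lin f" "lin g" "lin h" "a \<in> V"
  shows "conv (\<lambda>a. f a + g a) h a = conv f h a + conv g h a"
  unfolding conv_eq[OF linear_map_on_add_fun[OF assms(1,2)] assms(3,4)]
    conv_eq[OF assms(1,3,4)] conv_eq[OF assms(2-4)] lin_ext_fun_add[symmetric]
  by (rule lin_ext_cong)
    (use keys_comult[OF assms(4)] in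
      \<open>auto intro!: linear_map_onD(2)[OF lin_mult_right]
        linear_map_onD(1)[OF assms(1)] linear_map_onD(1)[OF assms(2)]
        linear_map_onD(1)[OF assms(3)]\<close>)

lemma conv_add_right:
  assumes "lin f" "lin g" "lin h" "a \<in> V"
  shows "conv h (\<lambda>a. f a + g a) a = conv h f a + conv h g a"
  unfolding conv_eq[OF assms(3) linear_map_on_add_fun[OF assms(1,2)] assms(4)]
    conv_eq[OF assms(3,1,4)] conv_eq[OF assms(3,2,4)] lin_ext_fun_add[symmetric]
  by (rule lin_ext_cong)
    (use keys_comult[OF assms(4)] in
      \<open>auto intro!: linear_map_onD(2)[OF lin_mult_left]
        linear_map_onD(1)[OF assms(1)] linear_map_onD(1)[OF assms(2)]
        linear_map_onD(1)[OF assms(3)]\<close>)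

lemma conv_scale_left:
  assumes "lin f" "lin h" "a \<in> V"
  shows "conv (\<lambda>a. c *\<^sub>k f a) h a = c *\<^sub>k conv f h a"
  unfolding conv_eq[OF linear_map_on_scale_fun[OF assms(1)] assms(2,3)]
    conv_eq[OF assms(1-3)] lin_ext_fun_scale[symmetric]
  by (rule lin_ext_cong)
    (use keys_comult[OF assms(3)] in
      \<open>auto intro!: linear_map_onD(3)[OF lin_mult_right]
        linear_map_onD(1)[OF assms(1)] linear_map_onD(1)[OF assms(2)]\<close>)

lemma conv_scale_right:
  assumes "lin f" "lin h" "a \<in> V"
  shows "conv h (\<lambda>a. c *\<^sub>k f a) a = c *\<^sub>k conv h f a"
  unfolding conv_eq[OF assms(2) linear_map_on_scale_fun[OF assms(1)] assms(3)]
    conv_eq[OF assms(2,1,3)] lin_ext_fun_scale[symmetric]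
  by (rule lin_ext_cong)
    (use keys_comult[OF assms(3)] in
      \<open>auto intro!: linear_map_onD(3)[OF lin_mult_left]
        linear_map_onD(1)[OF assms(1)] linear_map_onD(1)[OF assms(2)]\<close>)

section \<open>Uniqueness of the antipode\<close>

lemma conv_uminus_diff_left:
  assumes f: "lin f" and g: "lin g" and a: "a \<in> V"
  shows "conv (\<lambda>b. - f b - b) g a = - conv f g a - conv id g a"
proof -
  have *: "(\<lambda>b. - f b - b) = (\<lambda>b. (- 1) *\<^sub>k f b + (- 1) *\<^sub>k id b)" by (simp add: fun_eq_iff)
  show ?thesis
    unfolding * conv_add_left[OF linear_map_on_scale_fun[OF f]
        linear_map_on_scale_fun[OF linear_map_on_id] g a]
      conv_scale_left[OF f g a] conv_scale_left[OF linear_map_on_id g a]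
    by simp
qed

lemma conv_uminus_diff_right:
  assumes f: "lin f" and g: "lin g" and a: "a \<in> V"
  shows "conv g (\<lambda>b. - f b - b) a = - conv g f a - conv g id a"
proof -
  have *: "(\<lambda>b. - f b - b) = (\<lambda>b. (- 1) *\<^sub>k f b + (- 1) *\<^sub>k id b)" by (simp add: fun_eq_iff)
  show ?thesis
    unfolding * conv_add_right[OF linear_map_on_scale_fun[OF f]
        linear_map_on_scale_fun[OF linear_map_on_id] g a]
      conv_scale_right[OF f g a] conv_scale_right[OF linear_map_on_id g a]
    by simp
qed

lemma linear_uminus_diff: "lin f \<Longrightarrow> lin (\<lambda>b. - f b - b)"
  using linear_map_on_scale_fun[OF linear_map_on_add_fun[OF _ linear_map_on_id], where c = "- 1"]
  by simp

text \<open>The triple convolution of \<open>S\<close>, \<open>id\<close> and \<open>T\<close> is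
  bracketed in two ways, as for inverses in a monoid.\<close>

lemma antipode_unique:
  assumes S: "is_antipode B m \<Delta> S" and T: "is_antipode B m \<Delta> T" and a: "a \<in> V"
  shows "S a = T a"
proof -
  have lS: "lin S" and lT: "lin T" using S T by (auto simp: is_antipode_def)
  note li = linear_map_on_id[of V]
  have s: "conv S id b = - S b - b" if "b \<in> V" for b
    using S that by (auto simp: is_antipode_def circ_convolution_def algebra_simps eq_neg_iff_add_eq_0)
  have t: "conv id T b = - T b - b" if "b \<in> V" for b
    using T that by (auto simp: is_antipode_def circ_convolution_def algebra_simps eq_neg_iff_add_eq_0)
  have "- conv S T a - conv id T a = conv (\<lambda>b. - S b - b) T a"
    using conv_uminus_diff_left[OF lS lT a] by simp
  also have "\<dots> = conv (conv S id) T a"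
    by (rule conv_cong[OF linear_uminus_diff[OF lS] lT conv_linear[OF lS li] lT a])
      (simp_all only: s)
  also have "\<dots> = conv S (conv id T) a"
    by (rule conv_assoc[OF lS li lT a])
  also have "\<dots> = conv S (\<lambda>b. - T b - b) a"
    by (rule conv_cong[OF lS conv_linear[OF li lT] lS linear_uminus_diff[OF lT] a])
      (simp_all only: t)
  also have "\<dots> = - conv S T a - conv S id a"
    using conv_uminus_diff_right[OF lT lS a] .
  \<comment> \<open>Cancelling \<open>conv S T a\<close> leaves
    \<open>conv id T a = conv S id a\<close>, that is \<open>- T a - a = - S a - a\<close>.\<close>
  finally show ?thesis by (simp add: s[OF a] t[OF a])
qed

section \<open>The derivation and the convolution powers of the identity\<close>

abbreviation "D a \<equiv> tensor_lift m (\<Delta> a)"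

lemma D_eq_conv: "D a = conv id id a"
  by (simp add: convolution_def tensor_map_eq lin_ext_basis_vec_id case_prod_unfold)

lemma lin_D: "lin (\<lambda>a. D a)"
  unfolding D_eq_conv by (rule conv_linear[OF linear_map_on_id linear_map_on_id])

text \<open>By associativity, \<open>m\<close> turns the two actions on the tensor square into
  multiplication by \<open>a\<close> on the left and by \<open>b\<close> on the right.\<close>

lemma D_derivation:
  assumes a: "a \<in> V" and b: "b \<in> V"
  shows "D (m a b) = m a (D b) + m (D a) b"
proof -
  let ?e = "basis_vec :: 'b \<Rightarrow> 'b \<Rightarrow>\<^sub>0 'k"
  have "tensor_lift m (left_act m a (\<Delta> b)) =
      lin_ext (\<lambda>(p, q). tensor_lift m (m a (?e p) \<otimes>\<^sub>k ?e q)) (\<Delta> b)"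
    by (simp add: left_act_def tensor_lift_def lin_ext_lin_ext case_prod_unfold)
  also have "\<dots> = lin_ext (\<lambda>r. m a (case r of (p, q) \<Rightarrow> m (?e p) (?e q))) (\<Delta> b)"
    by (rule lin_ext_cong)
      (use keys_comult[OF b] a in
        \<open>auto simp: tensor_universal_property(2)[OF mult_bilinear] mult_closed mult_assoc\<close>)
  also have "\<dots> = m a (D b)"
    unfolding tensor_lift_def
    by (rule linear_map_on_lin_ext[OF lin_mult_left[OF a], symmetric])
      (use keys_comult[OF b] in \<open>auto intro: mult_closed\<close>)
  finally have 1: "tensor_lift m (left_act m a (\<Delta> b)) = m a (D b)" .
  have "tensor_lift m (right_act m (\<Delta> a) b) =
      lin_ext (\<lambda>(p, q). tensor_lift m (?e p \<otimes>\<^sub>k m (?e q) b)) (\<Delta> a)"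
    by (simp add: right_act_def tensor_lift_def lin_ext_lin_ext case_prod_unfold)
  also have "\<dots> = lin_ext (\<lambda>r. m (case r of (p, q) \<Rightarrow> m (?e p) (?e q)) b) (\<Delta> a)"
    by (rule lin_ext_cong)
      (use keys_comult[OF a] b in
        \<open>auto simp: tensor_universal_property(2)[OF mult_bilinear] mult_closed mult_assoc\<close>)
  also have "\<dots> = m (D a) b"
    unfolding tensor_lift_def
    by (rule linear_map_on_lin_ext[OF lin_mult_right[OF b], symmetric])
      (use keys_comult[OF a] in \<open>auto intro: mult_closed\<close>)
  finally have 2: "tensor_lift m (right_act m (\<Delta> a) b) = m (D a) b" .
  show ?thesis
    unfolding comult_derivation[OF a b] 1[symmetric] 2[symmetric]
    by (simp add: tensor_lift_def lin_ext_add)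
qed

lemma D_conv:
  assumes f: "lin f" and g: "lin g" and a: "a \<in> V"
  shows "D (conv f g a) = conv (\<lambda>a. D (f a)) g a + conv f (\<lambda>a. D (g a)) a"
proof -
  let ?e = "basis_vec :: 'b \<Rightarrow> 'b \<Rightarrow>\<^sub>0 'k"
  note cl = linear_map_onD(1)[OF f] linear_map_onD(1)[OF g]
  have "D (conv f g a) = lin_ext (\<lambda>r. D (case r of (b, c) \<Rightarrow> m (f (?e b)) (g (?e c)))) (\<Delta> a)"
    unfolding conv_eq[OF f g a]
    by (rule linear_map_on_lin_ext[OF lin_D]) (use keys_comult[OF a] in \<open>auto intro!: mult_closed cl\<close>)
  also have "\<dots> = lin_ext (\<lambda>r. (case r of (b, c) \<Rightarrow> m (D (f (?e b))) (g (?e c))) +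
                               (case r of (b, c) \<Rightarrow> m (f (?e b)) (D (g (?e c))))) (\<Delta> a)"
    by (rule lin_ext_cong) (use keys_comult[OF a] in \<open>auto simp: D_derivation cl\<close>)
  also have "\<dots> = conv (\<lambda>a. D (f a)) g a + conv f (\<lambda>a. D (g a)) a"
    by (simp add: lin_ext_fun_add conv_eq f g a linear_map_on_compose[OF f lin_D]
        linear_map_on_compose[OF g lin_D])
  finally show ?thesis .
qed

text \<open>\<open>conv_pow n\<close> is the convolution power with \<open>n + 1\<close> factors: convolution has no unit in general.\<close>

primrec conv_pow :: "nat \<Rightarrow> ('b \<Rightarrow>\<^sub>0 'k) \<Rightarrow> ('b \<Rightarrow>\<^sub>0 'k)" where
  "conv_pow 0 = id"
| "conv_pow (Suc n) = conv (conv_pow n) id"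

lemma lin_conv_pow: "lin (conv_pow n)"
  by (induction n) (simp_all add: linear_map_on_id conv_linear del: id_apply)

text \<open>\<open>conv_pow\<close> grows on the right, while one of the two antipode equations
  multiplies by \<open>id\<close> on the left.\<close>

lemma conv_id_conv_pow: "a \<in> V \<Longrightarrow> conv id (conv_pow n) a = conv_pow (Suc n) a"
proof (induction n arbitrary: a)
  case (Suc n)
  have "conv id (conv_pow (Suc n)) a = conv (conv id (conv_pow n)) id a"
    using conv_assoc[OF linear_map_on_id lin_conv_pow linear_map_on_id Suc.prems, of n]
    by (simp only: conv_pow.simps)
  also have "\<dots> = conv (conv_pow (Suc n)) id a"
    by (rule conv_cong[OF conv_linear[OF linear_map_on_id lin_conv_pow] linear_map_on_id lin_conv_pow
          linear_map_on_id Suc.prems Suc.IH refl])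
  finally show ?case by (simp only: conv_pow.simps)
qed simp

text \<open>A derivation acts on the product \<open>a\<^sub>1 \<cdots> a\<^sub>n\<close> factor by factor, and by coassociativity each
  of the summands is the same longer convolution power.\<close>

lemma D_conv_pow: "a \<in> V \<Longrightarrow> D (conv_pow n a) = of_nat (Suc n) *\<^sub>k conv_pow (Suc n) a"
proof (induction n arbitrary: a)
  case 0
  then show ?case by (simp add: D_eq_conv)
next
  case (Suc n)
  note li = linear_map_on_id[of V]
  have "D (conv_pow (Suc n) a) = conv (\<lambda>a. D (conv_pow n a)) id a + conv (conv_pow n) (\<lambda>a. D (id a)) a"
    using D_conv[OF lin_conv_pow li Suc.prems] by simp
  also have "conv (\<lambda>a. D (conv_pow n a)) id a = conv (\<lambda>a. of_nat (Suc n) *\<^sub>k conv_pow (Suc n) a) id a"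
    using Suc.IH Suc.prems
    by (intro conv_cong li linear_map_on_scale_fun lin_conv_pow linear_map_on_compose[OF lin_conv_pow lin_D])
      auto
  also have "\<dots> = of_nat (Suc n) *\<^sub>k conv_pow (Suc (Suc n)) a"
    unfolding conv_pow.simps
    by (rule conv_scale_left[OF lin_conv_pow[of "Suc n", unfolded conv_pow.simps] li Suc.prems])
  also have "conv (conv_pow n) (\<lambda>a. D (id a)) a = conv (conv_pow n) (conv id id) a"
    by (simp add: D_eq_conv)
  also have "\<dots> = conv_pow (Suc (Suc n)) a"
    using conv_assoc[OF lin_conv_pow li li Suc.prems, of n] by (simp only: conv_pow.simps)
  also have "of_nat (Suc n) *\<^sub>k conv_pow (Suc (Suc n)) a + conv_pow (Suc (Suc n)) a =
      of_nat (Suc (Suc n)) *\<^sub>k conv_pow (Suc (Suc n)) a"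
    by (simp only: of_nat_Suc[of "Suc n"] scale_pm.scale_left_distrib scale_pm.scale_one add.commute)
  finally show ?case .
qed

lemma D_funpow_closed: "a \<in> V \<Longrightarrow> ((\<lambda>a. D a) ^^ n) a \<in> V"
  by (induction n) (simp_all add: linear_map_onD(1)[OF lin_D])

lemma neg_D_funpow: "a \<in> V \<Longrightarrow> ((\<lambda>b. - D b) ^^ n) a = ((- 1) ^ n) *\<^sub>k ((\<lambda>b. D b) ^^ n) a"
  by (induction n)
    (simp_all add: linear_map_onD(3)[OF lin_D] D_funpow_closed)

end


section \<open>Exponential formula for the antipode\<close>

text \<open>This isolates what forests have to provide. The exponent may depend on \<open>a\<close>;
  characteristic 0 permits division by \<open>fact n\<close>.\<close>

locale nilpotent_eps_bialgebra = eps_unitary_bialgebra B m one \<Delta>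
  for B :: "'b set"
    and m :: "('b \<Rightarrow>\<^sub>0 'k::field_char_0) \<Rightarrow> ('b \<Rightarrow>\<^sub>0 'k) \<Rightarrow> ('b \<Rightarrow>\<^sub>0 'k)"
    and one :: "'b \<Rightarrow>\<^sub>0 'k"
    and \<Delta> :: "('b \<Rightarrow>\<^sub>0 'k) \<Rightarrow> ('b \<times> 'b \<Rightarrow>\<^sub>0 'k)" +
  assumes D_nilpotent: "a \<in> V \<Longrightarrow> \<exists>n. ((\<lambda>b. D b) ^^ n) a = 0"
begin

lemma D_funpow: "a \<in> V \<Longrightarrow> ((\<lambda>a. D a) ^^ n) a = fact n *\<^sub>k conv_pow n a"
proof (induction n)
  case (Suc n)
  then have "((\<lambda>a. D a) ^^ Suc n) a = D (fact n *\<^sub>k conv_pow n a)" by simp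
  also have "\<dots> = fact n *\<^sub>k D (conv_pow n a)"
    by (rule linear_map_onD(3)[OF lin_D linear_map_onD(1)[OF lin_conv_pow Suc.prems]])
  also have "\<dots> = fact (Suc n) *\<^sub>k conv_pow (Suc n) a"
    unfolding D_conv_pow[OF Suc.prems] scale_pm.scale_scale fact_Suc by (simp only: mult.commute)
  finally show ?case .
qed simp

lemma conv_pow_eq: "a \<in> V \<Longrightarrow> conv_pow n a = (1 / fact n) *\<^sub>k ((\<lambda>a. D a) ^^ n) a"
  by (simp add: D_funpow)

lemma lin_D_funpow: "lin ((\<lambda>b. D b) ^^ n)"
proof (induction n)
  case (Suc n)
  from linear_map_on_compose[OF Suc lin_D] show ?case by (simp add: o_def)
qed (simp add: linear_map_on_id del: id_apply)

lemma D_funpow_vanishes: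
  assumes "((\<lambda>b. D b) ^^ n) a = 0" "n \<le> k"
  shows "((\<lambda>b. D b) ^^ k) a = 0"
proof -
  have "((\<lambda>b. D b) ^^ (k - n + n)) a = 0"
    unfolding funpow_add o_apply assms(1) by (rule linear_map_on_0[OF lin_D_funpow])
  then show ?thesis using assms(2) by simp
qed

lemma conv_pow_vanishes:
  assumes "a \<in> V"
  shows "\<exists>N. \<forall>n\<ge>N. conv_pow n a = 0"
proof -
  obtain N where "((\<lambda>b. D b) ^^ N) a = 0" using D_nilpotent[OF assms] by blast
  then have "conv_pow n a = 0" if "N \<le> n" for n
    using that assms by (simp add: conv_pow_eq D_funpow_vanishes)
  then show ?thesis by blast
qed

text \<open>An identity between values of \<open>S\<close> at several elements needs one truncation
  that is exact at all of them.\<close>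

lemma conv_pow_vanishes_uniformly:
  assumes "finite A" "A \<subseteq> V"
  shows "\<exists>N. \<forall>a\<in>A. \<forall>n\<ge>N. conv_pow n a = 0"
  using assms
proof (induction A rule: finite_induct)
  case (insert a A)
  then obtain N M where "\<forall>b\<in>A. \<forall>n\<ge>N. conv_pow n b = 0" "\<forall>n\<ge>M. conv_pow n a = 0"
    using conv_pow_vanishes[of a] by blast
  then have "\<forall>b\<in>insert a A. \<forall>n\<ge>max N M. conv_pow n b = 0" by auto
  then show ?case by blast
qed simp

section \<open>The series and its truncations\<close>

definition S_trunc :: "nat \<Rightarrow> ('b \<Rightarrow>\<^sub>0 'k) \<Rightarrow> ('b \<Rightarrow>\<^sub>0 'k)" where
  "S_trunc N a = (\<Sum>n<N. ((- 1) ^ Suc n) *\<^sub>k conv_pow n a)"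

text \<open>The index set collects the nonzero terms. It is finite on \<open>V\<close>; a sum over
  an infinite set would default to 0.\<close>

definition S :: "('b \<Rightarrow>\<^sub>0 'k) \<Rightarrow> ('b \<Rightarrow>\<^sub>0 'k)" where
  "S a = - (\<Sum>n | ((\<lambda>b. - D b) ^^ n) a \<noteq> 0. (1 / fact n) *\<^sub>k ((\<lambda>b. - D b) ^^ n) a)"

lemma neg_D_funpow_eq: "a \<in> V \<Longrightarrow> ((\<lambda>b. - D b) ^^ n) a = ((- 1) ^ n * fact n) *\<^sub>k conv_pow n a"
  by (simp add: neg_D_funpow D_funpow)

lemma finite_nonzero_powers:
  assumes "a \<in> V"
  shows "finite {n. ((\<lambda>b. - D b) ^^ n) a \<noteq> 0}"
proof -
  obtain N where "\<forall>n\<ge>N. conv_pow n a = 0" using conv_pow_vanishes[OF assms] by blast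
  then have "{n. ((\<lambda>b. - D b) ^^ n) a \<noteq> 0} \<subseteq> {..<N}"
    using assms by (auto simp: neg_D_funpow_eq not_less[symmetric])
  then show ?thesis by (rule finite_subset) simp
qed

lemma S_eq_trunc:
  assumes "a \<in> V" "\<forall>n\<ge>N. conv_pow n a = 0"
  shows "S a = S_trunc N a"
proof -
  have "(\<Sum>n | ((\<lambda>b. - D b) ^^ n) a \<noteq> 0. (1 / fact n) *\<^sub>k ((\<lambda>b. - D b) ^^ n) a) =
      (\<Sum>n<N. (1 / fact n) *\<^sub>k ((\<lambda>b. - D b) ^^ n) a)"
    by (rule sum.mono_neutral_left)
      (use assms in \<open>auto simp: neg_D_funpow_eq not_less[symmetric]\<close>)
  also have "\<dots> = - S_trunc N a"
    using assms(1) by (simp add: S_trunc_def neg_D_funpow_eq sum_negf)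
  finally show ?thesis by (simp add: S_def)
qed

lemma lin_S_trunc: "lin (S_trunc N)"
proof (induction N)
  case 0
  then show ?case by (simp add: S_trunc_def linear_map_on_def free_space_0)
next
  case (Suc N)
  have "lin (\<lambda>a. S_trunc N a + ((- 1) ^ Suc N) *\<^sub>k conv_pow N a)"
    by (intro linear_map_on_add_fun linear_map_on_scale_fun Suc lin_conv_pow)
  then show ?case by (simp add: S_trunc_def[abs_def])
qed

lemma lin_S: "lin S"
proof -
  have "S u \<in> V \<and> S (u + v) = S u + S v \<and> S (c *\<^sub>k u) = c *\<^sub>k S u"
    if u: "u \<in> V" and v: "v \<in> V" for u v c
  proof -
    have in_V: "u + v \<in> V" "c *\<^sub>k u \<in> V" using u v by (auto intro: free_space_add free_space_scale)
    \<comment> \<open>One bound for all four vectors makes \<open>S\<close> agree on them with a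
      single linear map.\<close>
    then obtain N where "\<forall>a\<in>{u, v, u + v, c *\<^sub>k u}. \<forall>n\<ge>N. conv_pow n a = 0"
      using conv_pow_vanishes_uniformly[of "{u, v, u + v, c *\<^sub>k u}"] u v by auto
    then have "S a = S_trunc N a" if "a \<in> {u, v, u + v, c *\<^sub>k u}" for a
      using that u v in_V by (intro S_eq_trunc) auto
    then show ?thesis
      using linear_map_onD[OF lin_S_trunc] u v by auto
  qed
  then show ?thesis unfolding linear_map_on_def by blast
qed

text \<open>Convolving with \<open>id\<close> shifts \<open>conv_pow n\<close> to
  \<open>conv_pow (Suc n)\<close>. Up to sign this is the series with one more term and without its
  leading term \<open>- a\<close>, hence \<open>Suc N\<close> on the right.\<close>

lemma conv_S_trunc:
  assumes a: "a \<in> V"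
  shows "conv (S_trunc N) id a = - S_trunc (Suc N) a - a"
    and "conv id (S_trunc N) a = - S_trunc (Suc N) a - a"
proof (induction N)
  case 0
  {
    case 1
    have "m 0 c = 0" if "c \<in> V" for c
      using linear_map_on_0[OF lin_mult_right[OF that]] .
    then have "conv (S_trunc 0) id a = lin_ext (\<lambda>_. 0) (\<Delta> a)"
      unfolding conv_eq[OF lin_S_trunc linear_map_on_id a]
      by (intro lin_ext_cong) (use keys_comult[OF a] in \<open>auto simp: S_trunc_def\<close>)
    moreover have "- S_trunc (Suc 0) a - a = 0" by (simp add: S_trunc_def)
    ultimately show ?case by (simp only: lin_ext_fun_0)
  next
    case 2
    have "m c 0 = 0" if "c \<in> V" for c
      using linear_map_on_0[OF lin_mult_left[OF that]] .
    then have "conv id (S_trunc 0) a = lin_ext (\<lambda>_. 0) (\<Delta> a)"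
      unfolding conv_eq[OF linear_map_on_id lin_S_trunc a]
      by (intro lin_ext_cong) (use keys_comult[OF a] in \<open>auto simp: S_trunc_def\<close>)
    moreover have "- S_trunc (Suc 0) a - a = 0" by (simp add: S_trunc_def)
    ultimately show ?case by (simp only: lin_ext_fun_0)
  }
next
  case (Suc N)
  have step: "S_trunc (Suc N) = (\<lambda>a. S_trunc N a + ((- 1) ^ Suc N) *\<^sub>k conv_pow N a)" for N
    by (simp add: S_trunc_def fun_eq_iff)
  note li = linear_map_on_id[of V]
  {
    case 1
    have "conv (S_trunc (Suc N)) id a = conv (S_trunc N) id a + ((- 1) ^ Suc N) *\<^sub>k conv_pow (Suc N) a"
      unfolding step conv_add_left[OF lin_S_trunc linear_map_on_scale_fun[OF lin_conv_pow] li a]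
        conv_scale_left[OF lin_conv_pow li a] conv_pow.simps by (rule refl)
    also have "\<dots> = - S_trunc (Suc (Suc N)) a - a"
      unfolding Suc.IH step[of "Suc N"] by simp
    finally show ?case .
  next
    case 2
    have "conv id (S_trunc (Suc N)) a = conv id (S_trunc N) a + ((- 1) ^ Suc N) *\<^sub>k conv_pow (Suc N) a"
      unfolding step conv_add_right[OF lin_S_trunc linear_map_on_scale_fun[OF lin_conv_pow] li a]
        conv_scale_right[OF lin_conv_pow li a] conv_id_conv_pow[OF a] by (rule refl)
    also have "\<dots> = - S_trunc (Suc (Suc N)) a - a"
      unfolding Suc.IH step[of "Suc N"] by simp
    finally show ?case .
  }
qed

lemma antipode_S: "is_antipode B m \<Delta> S"
  unfolding is_antipode_def
proof (intro conjI ballI lin_S)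
  fix a :: "'b \<Rightarrow>\<^sub>0 'k"
  assume a: "a \<in> V"
  \<comment> \<open>Both convolutions evaluate \<open>S\<close> only at basis vectors in the legs of
    \<open>\<Delta> a\<close>, so a bound valid on these and on \<open>a\<close> suffices.\<close>
  let ?A = "insert a (basis_vec ` (fst ` Poly_Mapping.keys (\<Delta> a) \<union> snd ` Poly_Mapping.keys (\<Delta> a)))"
  have A: "finite ?A" "?A \<subseteq> V" using a keys_comult[OF a] by auto
  from conv_pow_vanishes_uniformly[OF A] obtain N where N: "\<forall>b\<in>?A. \<forall>n\<ge>N. conv_pow n b = 0" by blast
  have S: "S b = S_trunc N b" if "b \<in> ?A" for b
    by (rule S_eq_trunc[OF subsetD[OF A(2) that]]) (use N that in blast)
  have S_keys: "S (basis_vec b) = S_trunc N (basis_vec b) \<and> S (basis_vec c) = S_trunc N (basis_vec c)"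
    if "(b, c) \<in> Poly_Mapping.keys (\<Delta> a)" for b c
    by (intro conjI S) (use that in force)+
  \<comment> \<open>The length \<open>Suc N\<close> matches \<open>conv_S_trunc\<close>; the extra
    term is 0 at \<open>a\<close>.\<close>
  have "S a = S_trunc (Suc N) a" by (rule S_eq_trunc[OF a]) (use N in auto)
  moreover have "conv S id a = conv (S_trunc N) id a"
    unfolding conv_eq[OF lin_S linear_map_on_id a] conv_eq[OF lin_S_trunc linear_map_on_id a]
    by (rule lin_ext_cong) (auto simp: S_keys)
  moreover have "conv id S a = conv id (S_trunc N) a"
    unfolding conv_eq[OF linear_map_on_id lin_S a] conv_eq[OF linear_map_on_id lin_S_trunc a]
    by (rule lin_ext_cong) (auto simp: S_keys)
  ultimately show "circ_convolution m \<Delta> S id a = 0" "circ_convolution m \<Delta> id S a = 0"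
    by (simp_all add: circ_convolution_def conv_S_trunc[OF a])
qed

section \<open>Bijectivity of the antipode\<close>

text \<open>On the filtration by the kernels of the powers of \<open>D\<close>, the antipode acts as \<open>- id\<close> up to
  terms of lower filtration degree.\<close>

lemma D_funpow_S:
  assumes a: "a \<in> V" and k: "((\<lambda>b. D b) ^^ Suc k) a = 0"
  shows "((\<lambda>b. D b) ^^ k) (S a) = - ((\<lambda>b. D b) ^^ k) a"
proof -
  let ?Dk = "(\<lambda>b. D b) ^^ k"
  obtain N where N: "\<forall>n\<ge>N. conv_pow n a = 0" using conv_pow_vanishes[OF a] by blast
  have "S a = S_trunc (Suc N) a" by (rule S_eq_trunc[OF a]) (use N in auto)
  then have "?Dk (S a) = (\<Sum>n<Suc N. ?Dk (((- 1) ^ Suc n) *\<^sub>k conv_pow n a))"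
    unfolding S_trunc_def
    by (simp only:) (rule linear_map_on_sum[OF lin_D_funpow],
      auto intro!: free_space_scale linear_map_onD(1)[OF lin_conv_pow] a simp del: scale_pm.scale_minus_left)
  \<comment> \<open>\<open>D^k\<close> sends \<open>conv_pow n a\<close> to a multiple of
    \<open>D^(k + n) a\<close>, which vanishes for \<open>n > 0\<close> because
    \<open>D^(k + 1) a = 0\<close>.\<close>
  also have "\<dots> = (\<Sum>n<Suc N. if n = 0 then - ?Dk a else 0)"
  proof (rule sum.cong[OF refl])
    fix n
    have "?Dk (conv_pow n a) = 0" if "0 < n"
    proof -
      have "?Dk (conv_pow n a) = (1 / fact n) *\<^sub>k ((\<lambda>b. D b) ^^ (k + n)) a"
        by (simp add: conv_pow_eq[OF a] linear_map_onD(3)[OF lin_D_funpow] D_funpow_closed[OF a] funpow_add)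
      also have "((\<lambda>b. D b) ^^ (k + n)) a = 0"
        by (rule D_funpow_vanishes[OF k]) (use that in simp)
      finally show ?thesis by simp
    qed
    then show "?Dk (((- 1) ^ Suc n) *\<^sub>k conv_pow n a) = (if n = 0 then - ?Dk a else 0)"
      using linear_map_on_uminus[OF lin_D_funpow a]
      by (simp only: linear_map_onD(3)[OF lin_D_funpow] linear_map_onD(1)[OF lin_conv_pow] a) simp
  qed
  also have "\<dots> = - ?Dk a" by (simp add: sum.delta)
  finally show ?thesis .
qed

lemma bij_S: "bij_betw S V V"
proof (rule bij_betw_imageI)
  note diff = linear_map_onD(2)[OF lin_S] linear_map_on_uminus[OF lin_S] free_space_uminus
  \<comment> \<open>A vector killed by \<open>S\<close> drops one step in the kernel filtration at
    each stage, until \<open>D^0\<close> kills it.\<close>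
  have ker: "a = 0" if "a \<in> V" "S a = 0" "((\<lambda>b. D b) ^^ n) a = 0" for a n
    using that(3)
  proof (induction n)
    case (Suc n)
    then have "((\<lambda>b. D b) ^^ n) a = 0"
      using D_funpow_S[OF that(1) Suc.prems] that(2) linear_map_on_0[OF lin_D_funpow] by simp
    then show ?case by (rule Suc.IH)
  qed simp
  show "inj_on S V"
  proof (rule inj_onI)
    fix a b
    assume ab: "a \<in> V" "b \<in> V" "S a = S b"
    then have "a + - b \<in> V" "S (a + - b) = 0" by (simp_all only: diff free_space_add) simp
    with ker D_nilpotent have "a + - b = 0" by blast
    then show "a = b" by simp
  qed
  have surj: "b \<in> S ` V" if "((\<lambda>b. D b) ^^ n) b = 0" "b \<in> V" for n b
    using that
  proof (induction n arbitrary: b)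
    case 0
    then show ?case using linear_map_on_0[OF lin_S] by (force simp: free_space_0)
  next
    case (Suc n)
    have Sb: "S b \<in> V" using Suc.prems by (simp add: linear_map_onD(1)[OF lin_S])
    \<comment> \<open>The leading parts of \<open>b\<close> and \<open>S b\<close> cancel, so
      \<open>b + S b\<close> lies one step lower and equals some \<open>S c\<close> by induction;
      then \<open>b = S (c - b)\<close>.\<close>
    have "((\<lambda>b. D b) ^^ n) (b + S b) = 0"
      using D_funpow_S[OF Suc.prems(2,1)] linear_map_onD(2)[OF lin_D_funpow Suc.prems(2) Sb] by simp
    then obtain c where c: "c \<in> V" "b + S b = S c"
      using Suc.IH[of "b + S b"] Suc.prems Sb by (auto simp: free_space_add)
    have "S (c + - b) = S c + - S b" using c Suc.prems by (simp only: diff)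
    also have "\<dots> = b" by (simp add: c(2)[symmetric])
    finally have "b = S (c + - b)" by (rule sym)
    then show ?case using c Suc.prems by (blast intro: free_space_add free_space_uminus)
  qed
  show "S ` V = V"
    using surj D_nilpotent linear_map_onD(1)[OF lin_S] by blast
qed

theorem eps_unitary_Hopf_algebra: "eps_unitary_Hopf_algebra B m one \<Delta>"
  by unfold_locales (use antipode_S in blast)

theorem antipode_formula:
  assumes T: "is_antipode B m \<Delta> T"
  shows "bij_betw T V V"
    and "a \<in> V \<Longrightarrow> T a =
      - (\<Sum>n | ((\<lambda>b. - D b) ^^ n) a \<noteq> 0. (1 / fact n) *\<^sub>k ((\<lambda>b. - D b) ^^ n) a)"
proof -
  have eq: "T a = S a" if "a \<in> V" for a
    using antipode_unique[OF T antipode_S that] .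
  then show "bij_betw T V V" using bij_S bij_betw_cong[of V T S V] by blast
  show "T a = - (\<Sum>n | ((\<lambda>b. - D b) ^^ n) a \<noteq> 0. (1 / fact n) *\<^sub>k ((\<lambda>b. - D b) ^^ n) a)"
    if "a \<in> V"
    using eq[OF that] by (simp add: S_def)
qed

end

section \<open>Leaf-decorated forests\<close>

lemma m_RT_basis_vec [simp]: "m_RT (basis_vec F) (basis_vec G) = basis_vec (F @ G)"
  by (simp add: m_RT_def)

lemma B_plus_basis_vec [simp]: "B_plus (basis_vec F) = basis_vec [Graft F]"
  by (simp add: B_plus_def)

lemma Delta_eps_basis_vec [simp]: "Delta_eps (basis_vec F) = Delta_forest F"
  by (simp add: Delta_eps_def)

section \<open>The derivation rule on forests\<close>

lemma left_act_m_RT: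
  "left_act m_RT a t = lin_ext (\<lambda>F. lin_ext (\<lambda>(p, q). basis_vec (F @ p, q)) t) a"
  by (subst lin_ext_swap)
    (simp add: left_act_def tensor_lift_def m_RT_def lin_ext_lin_ext tensor_def case_prod_unfold)

lemma right_act_m_RT:
  "right_act m_RT t b = lin_ext (\<lambda>G. lin_ext (\<lambda>(p, q). basis_vec (p, q @ G)) t) b"
  by (subst lin_ext_swap)
    (simp add: right_act_def tensor_lift_def m_RT_def lin_ext_lin_ext tensor_def case_prod_unfold)

text \<open>The recursion separates one-tree forests from longer ones. The cases merge because
  \<open>Delta_forest []\<close> is 0 and the empty forest acts as the identity.\<close>

lemma Delta_forest_Cons:
  "Delta_forest (T # G) =
     left_act m_RT (basis_vec [T]) (Delta_forest G) + right_act m_RT (Delta_forest [T]) (basis_vec G)"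
  by (cases G) (simp_all add: left_act_m_RT right_act_m_RT lin_ext_basis_vec_id)

lemma Delta_forest_append:
  "Delta_forest (F @ G) =
     left_act m_RT (basis_vec F) (Delta_forest G) + right_act m_RT (Delta_forest F) (basis_vec G)"
proof (induction F)
  case Nil
  show ?case by (simp add: left_act_m_RT right_act_m_RT lin_ext_basis_vec_id)
next
  case (Cons T F)
  show ?case
    unfolding append_Cons Delta_forest_Cons[of T "F @ G"] Delta_forest_Cons[of T F] Cons.IH
    by (simp add: left_act_m_RT right_act_m_RT lin_ext_add lin_ext_lin_ext case_prod_unfold)
qed

lemma Delta_eps_m_RT:
  "Delta_eps (m_RT a b) = left_act m_RT a (Delta_eps b) + right_act m_RT (Delta_eps a) b"
proof -
  have "Delta_eps (m_RT a b) = lin_ext (\<lambda>F. lin_ext (\<lambda>G. Delta_forest (F @ G)) b) a"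
    by (simp add: Delta_eps_def m_RT_def lin_ext_lin_ext)
  also have "\<dots> = lin_ext (\<lambda>F. lin_ext (\<lambda>G. left_act m_RT (basis_vec F) (Delta_forest G)) b) a +
      lin_ext (\<lambda>F. lin_ext (\<lambda>G. right_act m_RT (Delta_forest F) (basis_vec G)) b) a"
    by (simp add: Delta_forest_append lin_ext_fun_add)
  also have "lin_ext (\<lambda>F. lin_ext (\<lambda>G. left_act m_RT (basis_vec F) (Delta_forest G)) b) a =
      left_act m_RT a (Delta_eps b)"
    by (simp add: left_act_m_RT Delta_eps_def lin_ext_lin_ext)
  also have "lin_ext (\<lambda>F. lin_ext (\<lambda>G. right_act m_RT (Delta_forest F) (basis_vec G)) b) a =
      right_act m_RT (Delta_eps a) b"
    by (subst lin_ext_swap) (simp add: right_act_m_RT Delta_eps_def lin_ext_lin_ext)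
  finally show ?thesis .
qed

section \<open>Coassociativity on forests\<close>

text \<open>This and \<open>comult_right\<close> are the iterated coproducts
  \<open>\<Delta> \<otimes> id\<close> and \<open>id \<otimes> \<Delta>\<close>, on basis triples
  nested to the right so that no reassociation remains.\<close>

definition comult_left :: "('x forest \<times> 'x forest \<Rightarrow>\<^sub>0 'k::field) \<Rightarrow> _" where
  "comult_left t = lin_ext (\<lambda>(p, r). lin_ext (\<lambda>(x, y). basis_vec (x, y, r)) (Delta_forest p)) t"

definition comult_right :: "('x forest \<times> 'x forest \<Rightarrow>\<^sub>0 'k::field) \<Rightarrow> _" where
  "comult_right t = lin_ext (\<lambda>(p, r). lin_ext (\<lambda>(x, y). basis_vec (p, x, y)) (Delta_forest r)) t"

text \<open>Either side expands into contributions of \<open>F\<close> and of \<open>G\<close>,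
  equal by hypothesis, and the same mixed term \<open>?M\<close>: in Sweedler notation,
  \<open>F1 \<otimes> F2 G1 \<otimes> G2\<close>.\<close>

lemma coassoc_append:
  fixes F G :: "'x forest"
  assumes F: "comult_left (Delta_forest F) = (comult_right (Delta_forest F) :: _ \<Rightarrow>\<^sub>0 'k::field)"
    and G: "comult_left (Delta_forest G) = (comult_right (Delta_forest G) :: _ \<Rightarrow>\<^sub>0 'k)"
  shows "comult_left (Delta_forest (F @ G)) = (comult_right (Delta_forest (F @ G)) :: _ \<Rightarrow>\<^sub>0 'k)"
proof -
  let ?L = "left_act m_RT (basis_vec F)" and ?R = "\<lambda>t. right_act m_RT t (basis_vec G)"
  let ?L3 = "lin_ext (\<lambda>(p, q, r). basis_vec (F @ p, q, r)) :: _ \<Rightarrow> _ \<Rightarrow>\<^sub>0 'k"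
  let ?R3 = "lin_ext (\<lambda>(p, q, r). basis_vec (p, q, r @ G)) :: _ \<Rightarrow> _ \<Rightarrow>\<^sub>0 'k"
  let ?M = "\<lambda>s t. lin_ext (\<lambda>(p, q). lin_ext (\<lambda>(x, y). basis_vec (x, y @ p, q)) s) t :: _ \<Rightarrow>\<^sub>0 'k"
  note simps = comult_left_def comult_right_def left_act_m_RT right_act_m_RT Delta_forest_append
    lin_ext_add lin_ext_fun_add lin_ext_lin_ext case_prod_unfold
  have "comult_left (?L t) = ?L3 (comult_left t) + ?M (Delta_forest F) t"
    for t :: "'x forest \<times> 'x forest \<Rightarrow>\<^sub>0 'k"
    by (simp add: simps)
  moreover have "comult_left (?R s) = ?R3 (comult_left s)"
    for s :: "'x forest \<times> 'x forest \<Rightarrow>\<^sub>0 'k"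
    by (simp add: simps)
  moreover have "comult_right (?L t) = ?L3 (comult_right t)"
    for t :: "'x forest \<times> 'x forest \<Rightarrow>\<^sub>0 'k"
    by (simp add: simps)
  moreover have "comult_right (?R s) = ?M s (Delta_forest G) + ?R3 (comult_right s)"
    for s :: "'x forest \<times> 'x forest \<Rightarrow>\<^sub>0 'k"
  proof -
    \<comment> \<open>The mixed term arises here with the sum over \<open>s\<close> outermost, so
      the double sum is interchanged.\<close>
    have M: "?M s t = lin_ext (\<lambda>(x, y). lin_ext (\<lambda>(p, q). basis_vec (x, y @ p, q)) t) s" for t
      unfolding case_prod_unfold by (rule lin_ext_swap)
    show ?thesis by (subst M) (simp add: simps)
  qed
  moreover have "comult_left (s + t) = comult_left s + comult_left t"
    "comult_right (s + t) = comult_right s + comult_right t" for s t :: "'x forest \<times> 'x forest \<Rightarrow>\<^sub>0 'k"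
    by (simp_all add: comult_left_def comult_right_def lin_ext_add)
  ultimately show ?thesis
    using F G by (simp add: Delta_forest_append)
qed

lemma coassoc_forest:
  "comult_left (Delta_forest F) = (comult_right (Delta_forest F) :: _ \<Rightarrow>\<^sub>0 'k::field)"
proof (induction F rule: Delta_forest.induct)
  case (3 F)
  let ?B3 = "lin_ext (\<lambda>(p, q, r). basis_vec (p, q, [Graft r])) :: _ \<Rightarrow> _ \<Rightarrow>\<^sub>0 'k"
  let ?J = "lin_ext (\<lambda>(p, q). basis_vec (p, q, [])) :: _ \<Rightarrow> _ \<Rightarrow>\<^sub>0 'k"
  note simps = comult_left_def comult_right_def one_RT_def tensor_map_eq
    lin_ext_add lin_ext_fun_add lin_ext_lin_ext case_prod_unfold
  have "comult_left (Delta_forest [Graft F]) =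
      ?J (Delta_forest F) + ?B3 (comult_left (Delta_forest F))"
    by (simp add: simps)
  also have "\<dots> = ?J (Delta_forest F) + ?B3 (comult_right (Delta_forest F))"
    by (simp only: 3)
  \<comment> \<open>On this side \<open>F \<otimes> 1\<close> contributes nothing since
    \<open>\<Delta> 1 = 0\<close>; \<open>?J\<close> comes from the grafting rule in the second
    leg.\<close>
  also have "\<dots> = comult_right (Delta_forest [Graft F])"
    by (simp add: simps)
  finally show ?case .
next
  case (4 T1 T2 Ts)
  then show ?case using coassoc_append[of "[T1]" "T2 # Ts"] by simp
qed (simp_all add: comult_left_def comult_right_def one_RT_def)

lemma coassoc_Delta_eps:
  fixes a :: "'x forest \<Rightarrow>\<^sub>0 'k::field"
  shows "tensor_assoc (tensor_map Delta_eps id (Delta_eps a)) = tensor_map id Delta_eps (Delta_eps a)"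
proof -
  have "tensor_assoc (tensor_map Delta_eps id t) = comult_left t"
    "tensor_map id Delta_eps t = comult_right t"
    for t :: "'x forest \<times> 'x forest \<Rightarrow>\<^sub>0 'k"
    using lin_ext_left_comult[of basis_vec Delta_eps t] lin_ext_right_comult[of basis_vec Delta_eps t]
    by (simp_all add: lin_ext_basis_vec_id comult_left_def comult_right_def case_prod_unfold)
  moreover have "comult_left (Delta_eps a) = lin_ext (\<lambda>F. comult_left (Delta_forest F)) a"
    "comult_right (Delta_eps a) = lin_ext (\<lambda>F. comult_right (Delta_forest F)) a"
    by (simp_all add: comult_left_def comult_right_def Delta_eps_def lin_ext_lin_ext)
  ultimately show ?thesis by (simp add: coassoc_forest)
qed

section \<open>Vertex count and local nilpotence\<close>

primrec vertices :: "'x ltree \<Rightarrow> nat" where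
  "vertices (Leaf x) = 1"
| "vertices (Graft ts) = Suc (sum_list (map vertices ts))"

definition degree :: "'x forest \<Rightarrow> nat" where
  "degree F = sum_list (map vertices F)"

text \<open>Decorations and vertex counts are tracked by one induction. The \<open>+ 1\<close> is
  the deleted vertex: the leaf in \<open>1 \<otimes> 1\<close>, the new root in
  \<open>F \<otimes> 1\<close>.\<close>

lemma Delta_forest_closed:
  "F \<in> forests X \<Longrightarrow> (Delta_forest F :: _ \<Rightarrow>\<^sub>0 'k::field) \<in>
     free_space {(p, q). p \<in> forests X \<and> q \<in> forests X \<and> degree p + degree q + 1 = degree F}"
proof (induction F rule: Delta_forest.induct)
  case (3 F)
  then have F: "F \<in> forests X" by (auto simp: forests_def)
  let ?C = "free_space {(p, q). p \<in> forests X \<and> q \<in> forests X \<and>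
    degree p + degree q + 1 = degree [Graft F]} :: (_ \<Rightarrow>\<^sub>0 'k) set"
  have "basis_vec (F, []) \<in> ?C"
    using F by (intro free_space_basis_vec) (auto simp: forests_def degree_def)
  moreover have "basis_vec (p, [Graft q]) \<in> ?C"
    if "(p, q) \<in> Poly_Mapping.keys (Delta_forest F :: _ \<Rightarrow>\<^sub>0 'k)" for p q
    using free_space_keys[OF "3.IH"[OF F] that]
    by (intro free_space_basis_vec) (auto simp: forests_def degree_def)
  then have "tensor_map id B_plus (Delta_forest F) \<in> ?C"
    unfolding tensor_map_eq by (intro lin_ext_closed) auto
  ultimately show ?case by (simp add: one_RT_def free_space_add)
next
  case (4 T1 T2 Ts)
  let ?C = "free_space {(p, q). p \<in> forests X \<and> q \<in> forests X \<and>
    degree p + degree q + 1 = degree (T1 # T2 # Ts)} :: (_ \<Rightarrow>\<^sub>0 'k) set"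
  have T: "[T1] \<in> forests X" "T2 # Ts \<in> forests X" using "4.prems" by (auto simp: forests_def)
  have "basis_vec (T1 # p, q) \<in> ?C"
    if "(p, q) \<in> Poly_Mapping.keys (Delta_forest (T2 # Ts) :: _ \<Rightarrow>\<^sub>0 'k)" for p q
    using free_space_keys[OF "4.IH"(1)[OF T(2)] that] T
    by (intro free_space_basis_vec) (auto simp: forests_def degree_def)
  then have "left_act m_RT (basis_vec [T1]) (Delta_forest (T2 # Ts)) \<in> ?C"
    unfolding left_act_m_RT lin_ext_basis_vec by (intro lin_ext_closed) auto
  moreover have "basis_vec (p, q @ T2 # Ts) \<in> ?C"
    if "(p, q) \<in> Poly_Mapping.keys (Delta_forest [T1] :: _ \<Rightarrow>\<^sub>0 'k)" for p q
    using free_space_keys[OF "4.IH"(2)[OF T(1)] that] T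
    by (intro free_space_basis_vec) (auto simp: forests_def degree_def)
  then have "right_act m_RT (Delta_forest [T1]) (basis_vec (T2 # Ts)) \<in> ?C"
    unfolding right_act_m_RT lin_ext_basis_vec by (intro lin_ext_closed) auto
  ultimately show ?case by (simp add: free_space_add)
qed (auto simp: free_space_0 one_RT_def forests_def degree_def intro: free_space_basis_vec)

lemma D_eps_eq: "D_eps a = lin_ext (\<lambda>F. lin_ext (\<lambda>(p, q). basis_vec (p @ q)) (Delta_forest F)) a"
  by (simp add: D_eps_def Delta_eps_def tensor_lift_def lin_ext_lin_ext)

lemma D_eps_lowers_degree:
  fixes a :: "'x forest \<Rightarrow>\<^sub>0 'k::field"
  assumes "a \<in> free_space {F. degree F < Suc n}"
  shows "D_eps a \<in> free_space {F. degree F < n}"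
proof -
  have "degree (p @ q) < n"
    if "(p, q) \<in> Poly_Mapping.keys (Delta_forest F :: _ \<Rightarrow>\<^sub>0 'k)" "F \<in> Poly_Mapping.keys a" for p q F
  proof -
    have "F \<in> forests UNIV" by (auto simp: forests_def)
    from free_space_keys[OF Delta_forest_closed[OF this] that(1)] free_space_keys[OF assms that(2)]
    show ?thesis by (simp add: degree_def)
  qed
  then show ?thesis
    unfolding D_eps_eq by (auto intro!: lin_ext_closed free_space_basis_vec)
qed

lemma D_eps_nilpotent: "\<exists>n. (D_eps ^^ n) a = 0"
proof -
  \<comment> \<open>The bound is strict, so that for \<open>n = 0\<close> the space contains only
    0.\<close>
  have "(D_eps ^^ n) a = 0" if "a \<in> free_space {F. degree F < n}" for n
    using that
  proof (induction n arbitrary: a)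
    case (Suc n)
    then show ?case unfolding funpow_Suc_right o_apply by (blast intro: D_eps_lowers_degree)
  qed (simp add: free_space_def)
  moreover have "\<exists>n. \<forall>F\<in>Poly_Mapping.keys a. degree F < n"
    using finite_nat_set_iff_bounded[of "degree ` Poly_Mapping.keys a"] by simp
  ultimately show ?thesis by (force simp: free_space_def)
qed

section \<open>The Hopf algebra of forests\<close>

lemma nilpotent_eps_bialgebra_forests:
  "nilpotent_eps_bialgebra (forests X)
     (m_RT :: ('x forest \<Rightarrow>\<^sub>0 'k::field_char_0) \<Rightarrow> _ \<Rightarrow> _) one_RT Delta_eps"
proof unfold_locales
  let ?V = "free_space (forests X) :: ('x forest \<Rightarrow>\<^sub>0 'k) set"
  have append: "F @ G \<in> forests X" if "F \<in> forests X" "G \<in> forests X" for F G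
    using that by (simp add: forests_def)
  have "m_RT u v \<in> ?V" if "u \<in> ?V" "v \<in> ?V" for u v
    unfolding m_RT_def
    using that by (auto intro!: lin_ext_closed free_space_basis_vec append dest: free_space_keys)
  then show "bilinear_map_on ?V ?V ?V m_RT"
    by (simp add: bilinear_map_on_def linear_map_on_def m_RT_def lin_ext_add lin_ext_scale
        lin_ext_fun_add lin_ext_fun_scale)
  show "linear_map_on ?V (free_space (forests X \<times> forests X)) Delta_eps"
    unfolding Delta_eps_def
  proof (rule linear_lin_ext)
    fix F
    assume "F \<in> forests X"
    from Delta_forest_closed[OF this, where 'k = 'k]
    show "(Delta_forest F :: _ \<Rightarrow>\<^sub>0 'k) \<in> free_space (forests X \<times> forests X)"
      by (auto simp: free_space_def)
  qed
  show "m_RT (m_RT a b) c = m_RT a (m_RT b c)" for a b c :: "'x forest \<Rightarrow>\<^sub>0 'k"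
    by (simp add: m_RT_def lin_ext_lin_ext)
  show "\<exists>n. ((\<lambda>b. tensor_lift m_RT (Delta_eps b)) ^^ n) a = 0" for a :: "'x forest \<Rightarrow>\<^sub>0 'k"
    using D_eps_nilpotent[of a] by (simp add: D_eps_def[abs_def])
qed (simp_all only: coassoc_Delta_eps Delta_eps_m_RT,
    simp_all add: m_RT_def one_RT_def lin_ext_basis_vec_id free_space_basis_vec forests_def)

text \<open>The antipode is quantified because its values outside \<open>H_ell X\<close> are free;
  the first conjunct supplies one. Finiteness of the index set makes the sum the genuine series and
  not a default value.\<close>

theorem theorem3p10:
  fixes X :: "'x set"
  shows "eps_unitary_Hopf_algebra (forests X)
           (m_RT :: ('x forest \<Rightarrow>\<^sub>0 'k::field_char_0) \<Rightarrow> _ \<Rightarrow> _) one_RT Delta_eps \<and>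
         (\<forall>S :: ('x forest \<Rightarrow>\<^sub>0 'k) \<Rightarrow> ('x forest \<Rightarrow>\<^sub>0 'k).
            is_antipode (forests X) m_RT Delta_eps S \<longrightarrow>
            bij_betw S (H_ell X) (H_ell X) \<and>
            (\<forall>a\<in>H_ell X.
               finite {n. ((\<lambda>b. - D_eps b) ^^ n) a \<noteq> 0} \<and>
               S a = - (\<Sum>n | ((\<lambda>b. - D_eps b) ^^ n) a \<noteq> 0.
                          (1 / fact n) *\<^sub>k ((\<lambda>b. - D_eps b) ^^ n) a)))"
proof -
  interpret nilpotent_eps_bialgebra "forests X"
    "m_RT :: ('x forest \<Rightarrow>\<^sub>0 'k) \<Rightarrow> _ \<Rightarrow> _" one_RT Delta_eps
    by (rule nilpotent_eps_bialgebra_forests)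
  show ?thesis
    using eps_unitary_Hopf_algebra antipode_formula finite_nonzero_powers
    unfolding H_ell_def D_eps_def[abs_def] by blast
qed

end
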